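(* Let $f:\Omega\to\mathbb{R}^{d'}$ be $\pi$-integrable and $\mu=\int_\Omega f(x)\pi(x)\,dx$. Suppose the underlying Markov chain of the importance sampling MP-MCMC algorithm described in the context is positive Harris. Then the sequence of importance sampling estimators $$\mu_L=\frac1L\sum_{\ell=1}^L\sum_{i=1}^{N+1}w_i^{(\ell)}f\big(y_i^{(\ell)}\big),\qquad L\ge1,$$ is asymptotically unbiased, i.e. $\mathbb{E}[\mu_L]\to\mu$ as $L\to\infty$.
   Context: Let $d,d',N\in\mathbb{N}$, $\Omega\subset\mathbb{R}^d$, and let $\pi$ be a probability density (the target) on $\Omega$. For $y_{1:N+1}=(y_1,\dots,y_{N+1})\in\Omega^{N+1}$ write $y_{\setminus i}=(y_1,\dots,y_{i-1},y_{i+1},\dots,y_{N+1})$. A proposal kernel $\kappa$ assigns to each $y\in\Omega$ a probability density $\kappa(y,\cdot)$ on $\Omega^N$. Importance sampling MP-MCMC (IS-MP-MCMC): start with $y_1\in\Omega$ and index $I=1$. In iteration $\ell=1,2,\dots$: (1) keep $y_I$ and draw $y_{\setminus I}\sim\kappa(y_I,\cdot)$, giving the proposals $y^{(\ell)}_{1:N+1}$; (2) compute the weights $$w^{(\ell)}_i=p(I=i\mid y_{1:N+1}^{(\ell)})=\frac{\pi(y^{(\ell)}_i)\kappa(y^{(\ell)}_i,y^{(\ell)}_{\setminus i})}{\sum_{j=1}^{N+1}\pi(y^{(\ell)}_j)\kappa(y^{(\ell)}_j,y^{(\ell)}_{\setminus j})},\quad i=1,\dots,N+1;$$ (3) use $\sum_i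 w^{(\ell)}_if(y_i^{(\ell)})$ as the contribution of iteration $\ell$ to the running average $\mu_L$; (4) draw one new index $I$ from $p(\cdot\mid y^{(\ell)}_{1:N+1})$ and continue. The underlying Markov chain is the chain of states $(y_{1:N+1},I)$ on $\Omega^{N+1}\times\{1,\dots,N+1\}$ generated by this algorithm (the multiple-proposal Metropolis-Hastings chain with one accepted sample $y_I$ per iteration); its updates preserve the joint density $p(y_{1:N+1},I=i)=\frac1{N+1}\pi(y_i)\kappa(y_i,y_{\setminus i})$. Positive Harris means Harris recurrent with an invariant probability distribution.
   Formalization: For unbounded f the claim is proved for π-almost every starting point y_1 rather than every y_1 in Ω, where it can fail (E[μ_L] may be infinite from an exceptional y_1); for f bounded on Ω it is proved for every y_1. *)

theory Defs
  imports "HOL-Probability.Probability"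
begin

definition markov_kernel :: "'s measure \<Rightarrow> ('s \<Rightarrow> 's measure) \<Rightarrow> bool" where
  "markov_kernel S K \<longleftrightarrow> K \<in> measurable S (prob_algebra S)"

text \<open>The law on path space (coordinates \<open>\<omega> 0, \<omega> 1, \<dots>\<close>) of the chain with transition kernel
  \<open>K\<close> started at \<open>\<omega> 0 = x\<close>: the infinite product of Ionescu-Tulcea.\<close>

definition chain_law :: "'s measure \<Rightarrow> ('s \<Rightarrow> 's measure) \<Rightarrow> 's \<Rightarrow> (nat \<Rightarrow> 's) measure" where
  "chain_law S K x =
     (let P = (\<lambda>n \<omega>. if n = 0 then return S x else K (\<omega> (n - 1)))
      in projective_family.lim UNIV (Ionescu_Tulcea.CI P (\<lambda>_. S)) (\<lambda>_. S))"

definition irreducible_wrt :: "'s measure \<Rightarrow> ('s \<Rightarrow> 's measure) \<Rightarrow> 's measure \<Rightarrow> bool" where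
  "irreducible_wrt S K \<psi> \<longleftrightarrow>
     sets \<psi> = sets S \<and> sigma_finite_measure \<psi> \<and> emeasure \<psi> (space S) \<noteq> 0 \<and>
     (\<forall>x\<in>space S. \<forall>A\<in>sets S. emeasure \<psi> A > 0 \<longrightarrow>
        emeasure (chain_law S K x) {\<omega> \<in> space (chain_law S K x). \<exists>n\<ge>1. \<omega> n \<in> A} > 0)"

definition harris_recurrent :: "'s measure \<Rightarrow> ('s \<Rightarrow> 's measure) \<Rightarrow> bool" where
  "harris_recurrent S K \<longleftrightarrow>
     (\<exists>\<psi>. irreducible_wrt S K \<psi> \<and>
        (\<forall>A\<in>sets S. emeasure \<psi> A > 0 \<longrightarrow>
           (\<forall>x\<in>A. AE \<omega> in chain_law S K x. \<exists>\<^sub>\<infinity>n. \<omega> n \<in> A)))"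

definition invariant_distribution :: "'s measure \<Rightarrow> ('s \<Rightarrow> 's measure) \<Rightarrow> 's measure \<Rightarrow> bool" where
  "invariant_distribution S K \<nu> \<longleftrightarrow>
     prob_space \<nu> \<and> sets \<nu> = sets S \<and> (\<nu> \<bind> K) = \<nu>"

definition positive_harris :: "'s measure \<Rightarrow> ('s \<Rightarrow> 's measure) \<Rightarrow> bool" where
  "positive_harris S K \<longleftrightarrow>
     markov_kernel S K \<and> harris_recurrent S K \<and> (\<exists>\<nu>. invariant_distribution S K \<nu>)"

definition prob_density :: "'s measure \<Rightarrow> ('s \<Rightarrow> real) \<Rightarrow> bool" where
  "prob_density M g \<longleftrightarrow>
     g \<in> borel_measurable M \<and> (\<forall>x\<in>space M. 0 \<le> g x) \<and> (\<integral>\<^sup>+x. ennreal (g x) \<partial>M) = 1"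

text \<open>Lebesgue measure on \<open>\<Omega>\<close>, and on \<open>\<Omega>\<^sup>n\<close> whose elements are functions on \<open>{1..n}\<close>.\<close>

abbreviation leb_on :: "'a::euclidean_space set \<Rightarrow> 'a measure" where
  "leb_on \<Omega> \<equiv> restrict_space lborel \<Omega>"

abbreviation leb_tuples :: "'a::euclidean_space set \<Rightarrow> nat \<Rightarrow> (nat \<Rightarrow> 'a) measure" where
  "leb_tuples \<Omega> n \<equiv> PiM {1..n} (\<lambda>_. leb_on \<Omega>)"

definition target :: "'a::euclidean_space set \<Rightarrow> ('a \<Rightarrow> real) \<Rightarrow> 'a measure" where
  "target \<Omega> p = density (leb_on \<Omega>) (\<lambda>x. ennreal (p x))"

definition proposal_kernel ::
    "'a::euclidean_space set \<Rightarrow> nat \<Rightarrow> ('a \<Rightarrow> (nat \<Rightarrow> 'a) \<Rightarrow> real) \<Rightarrow> bool" where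
  "proposal_kernel \<Omega> N \<kappa> \<longleftrightarrow>
     (\<lambda>(x, z). \<kappa> x z) \<in> borel_measurable (leb_on \<Omega> \<Otimes>\<^sub>M leb_tuples \<Omega> N) \<and>
     (\<forall>x\<in>\<Omega>. prob_density (leb_tuples \<Omega> N) (\<kappa> x))"

text \<open>\<open>omit N i y\<close> is \<open>y\<close> without its \<open>i\<close>-th entry; \<open>insert_at N i x z\<close> is the
  \<open>(N+1)\<close>-tuple whose \<open>i\<close>-th entry is \<open>x\<close> and whose remaining entries form \<open>z\<close>.\<close>

definition omit :: "nat \<Rightarrow> nat \<Rightarrow> (nat \<Rightarrow> 'a) \<Rightarrow> (nat \<Rightarrow> 'a)" where
  "omit N i y = (\<lambda>j\<in>{1..N}. if j < i then y j else y (j + 1))"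

definition insert_at :: "nat \<Rightarrow> nat \<Rightarrow> 'a \<Rightarrow> (nat \<Rightarrow> 'a) \<Rightarrow> (nat \<Rightarrow> 'a)" where
  "insert_at N i x z = (\<lambda>j\<in>{1..N+1}. if j < i then z j else if j = i then x else z (j - 1))"

text \<open>The quotient defining the weights is meaningless where its denominator vanishes. This
  happens with probability zero once \<open>p (y i) > 0\<close> for the current index \<open>i\<close>; on this
  exceptional set the weights are taken to be uniform, so that they always form a probability
  vector.\<close>

definition mp_weight ::
    "nat \<Rightarrow> ('a \<Rightarrow> real) \<Rightarrow> ('a \<Rightarrow> (nat \<Rightarrow> 'a) \<Rightarrow> real) \<Rightarrow> (nat \<Rightarrow> 'a) \<Rightarrow> nat \<Rightarrow> real" where
  "mp_weight N p \<kappa> y i =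
     (let D = (\<Sum>j\<in>{1..N+1}. p (y j) * \<kappa> (y j) (omit N j y))
      in if D = 0 then 1 / real (N + 1) else p (y i) * \<kappa> (y i) (omit N i y) / D)"

definition mp_states :: "'a::euclidean_space set \<Rightarrow> nat \<Rightarrow> ((nat \<Rightarrow> 'a) \<times> nat) measure" where
  "mp_states \<Omega> N = leb_tuples \<Omega> (N + 1) \<Otimes>\<^sub>M count_space {1..N+1}"

text \<open>One iteration from the state \<open>(y, i)\<close>: keep \<open>y i\<close>, draw the other entries from
  \<open>\<kappa> (y i)\<close>, then draw the new index from the weights of the new tuple.\<close>

definition mp_kernel ::
    "'a::euclidean_space set \<Rightarrow> nat \<Rightarrow> ('a \<Rightarrow> real) \<Rightarrow> ('a \<Rightarrow> (nat \<Rightarrow> 'a) \<Rightarrow> real) \<Rightarrow>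
       (nat \<Rightarrow> 'a) \<times> nat \<Rightarrow> ((nat \<Rightarrow> 'a) \<times> nat) measure" where
  "mp_kernel \<Omega> N p \<kappa> = (\<lambda>(y, i).
     density (leb_tuples \<Omega> N) (\<lambda>z. ennreal (\<kappa> (y i) z)) \<bind> (\<lambda>z.
       let y' = insert_at N i (y i) z
       in distr (point_measure {1..N+1} (\<lambda>j. ennreal (mp_weight N p \<kappa> y' j)))
            (mp_states \<Omega> N) (\<lambda>j. (y', j))))"

text \<open>The law of the algorithm started with \<open>y1\<close> and \<open>I = 1\<close>. Coordinate \<open>\<omega> l\<close> is the state
  after iteration \<open>l\<close>; coordinate \<open>0\<close> only serves to hold the starting point (the transitions
  read nothing but the entry of the tuple at the current index).\<close>

definition mp_run ::
    "'a::euclidean_space set \<Rightarrow> nat \<Rightarrow> ('a \<Rightarrow> real) \<Rightarrow> ('a \<Rightarrow> (nat \<Rightarrow> 'a) \<Rightarrow> real) \<Rightarrow> 'a \<Rightarrow>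
       (nat \<Rightarrow> (nat \<Rightarrow> 'a) \<times> nat) measure" where
  "mp_run \<Omega> N p \<kappa> y1 = chain_law (mp_states \<Omega> N) (mp_kernel \<Omega> N p \<kappa>) (\<lambda>j\<in>{1..N+1}. y1, 1)"

definition is_estimator ::
    "nat \<Rightarrow> ('a \<Rightarrow> real) \<Rightarrow> ('a \<Rightarrow> (nat \<Rightarrow> 'a) \<Rightarrow> real) \<Rightarrow> ('a \<Rightarrow> 'b::real_vector) \<Rightarrow>
       nat \<Rightarrow> (nat \<Rightarrow> (nat \<Rightarrow> 'a) \<times> nat) \<Rightarrow> 'b" where
  "is_estimator N p \<kappa> f L \<omega> =
     (1 / real L) *\<^sub>R (\<Sum>l = 1..L. \<Sum>i = 1..N+1. mp_weight N p \<kappa> (fst (\<omega> l)) i *\<^sub>R f (fst (\<omega> l) i))"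

text \<open>Integrability is part of the notion, since the Bochner integral of a non-integrable
  function is \<open>0\<close> by convention.\<close>

definition asymptotically_unbiased ::
    "'s measure \<Rightarrow> (nat \<Rightarrow> 's \<Rightarrow> 'b::{banach, second_countable_topology}) \<Rightarrow> 'b \<Rightarrow> bool" where
  "asymptotically_unbiased M T \<theta> \<longleftrightarrow>
     (\<forall>L\<ge>1. integrable M (T L)) \<and> (\<lambda>L. \<integral>\<omega>. T L \<omega> \<partial>M) \<longlonglongrightarrow> \<theta>"

end

theory Submission
  imports Defs
begin

text \<open>
  The expected estimator is a Cesaro average \<open>(1/n) (T g + \<dots> + T\<^sup>n g)\<close> of the transition operator
  \<open>T\<close>, evaluated at the starting state, where \<open>g\<close> is the weighted sum of \<open>f\<close> over the proposals; the
  joint density is invariant for \<open>T\<close> and gives \<open>g\<close> the integral \<open>\<mu>\<close>. Hopf's maximal inequality and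
  irreducibility yield the pointwise ergodic theorem: for bounded \<open>g\<close> the upper limit \<open>u\<close> of the averages
  satisfies \<open>u \<le> T u\<close>, so its level sets are absorbing up to null sets and \<open>u\<close> is almost everywhere
  constant; the unbounded case follows by truncation. For bounded \<open>g\<close> Harris recurrence removes the
  exceptional null set, since from every state the chain almost surely enters an absorbing set of
  full measure. Finally, a transition reads only the current point, so a statement that holds for
  almost every state under the joint density holds for almost every starting point under the target.
\<close>

section \<open>Transition operators\<close>

text \<open>The claim concerns expectations, so an almost sure law of large numbers along the paths
  would not suffice without uniform integrability; hence the averages of powers of the operator are
  studied directly, at a fixed state. The values lie in \<open>ennreal\<close>, where subtraction is
  truncated: functions are nonnegative, for bounded \<open>g\<close> limits come from upper limits
  alone by treating \<open>g\<close> and \<open>B - g\<close> alike, and signs enter only at the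
  end, through positive and negative parts of the coordinates of \<open>f\<close>. The averaged
  function is \<open>T g\<close> and not \<open>g\<close>, because the estimator begins after the
  first transition; this also makes every term depend on the start only through the current point.
  The split of the conclusion into almost every start and every start has a reason: at an
  exceptional point \<open>x\<close> the density \<open>\<kappa> x\<close> can be such that even the
  first iteration has infinite expectation for an integrable \<open>f\<close>, which recurrence
  cannot repair. For bounded \<open>f\<close> an exceptional null set contributes at most its
  probability times the bound.\<close>

definition transfer :: "('s \<Rightarrow> 's measure) \<Rightarrow> ('s \<Rightarrow> ennreal) \<Rightarrow> 's \<Rightarrow> ennreal" where
  "transfer K g x = (\<integral>\<^sup>+y. g y \<partial>K x)"

text \<open>For \<open>n = 0\<close> this is \<open>0 / 0\<close>, which is \<open>0\<close> in
  \<open>ennreal\<close>; upper bounds such as \<open>avg_le\<close> then hold for every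
  \<open>n\<close>, while \<open>avg_const\<close> needs \<open>n \<ge> 1\<close>.\<close>

definition ergodic_average ::
    "('s \<Rightarrow> 's measure) \<Rightarrow> nat \<Rightarrow> ('s \<Rightarrow> ennreal) \<Rightarrow> 's \<Rightarrow> ennreal" where
  "ergodic_average K n g x = (\<Sum>l<n. (transfer K ^^ l) g x) / of_nat n"

locale transition_kernel =
  fixes S :: "'s measure" and K :: "'s \<Rightarrow> 's measure"
  assumes kernel: "K \<in> measurable S (prob_algebra S)"
begin

abbreviation T where "T \<equiv> transfer K"
abbreviation avg where "avg \<equiv> ergodic_average K"

lemma kernel_subprob [measurable]: "K \<in> measurable S (subprob_algebra S)"
  by (rule measurable_prob_algebraD[OF kernel])

lemma prob_space_K: "x \<in> space S \<Longrightarrow> prob_space (K x)"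
  using measurable_space[OF kernel, of x] by (simp add: space_prob_algebra)

lemma sets_K: "x \<in> space S \<Longrightarrow> sets (K x) = sets S"
  using measurable_space[OF kernel, of x] by (simp add: space_prob_algebra)

lemma space_K: "x \<in> space S \<Longrightarrow> space (K x) = space S"
  using sets_K by (rule sets_eq_imp_space_eq)

lemma measurable_K: "x \<in> space S \<Longrightarrow> measurable (K x) N = measurable S N"
  using sets_K by (intro measurable_cong_sets) auto

lemma T_measurable [measurable (raw)]:
  "g \<in> borel_measurable S \<Longrightarrow> T g \<in> borel_measurable S"
  unfolding transfer_def
  by (rule measurable_compose[OF kernel_subprob nn_integral_measurable_subprob_algebra])

lemma T_pow_measurable [measurable (raw)]:
  "g \<in> borel_measurable S \<Longrightarrow> (T ^^ n) g \<in> borel_measurable S"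
  by (induction n) (auto intro: T_measurable)

lemma avg_measurable [measurable (raw)]:
  "g \<in> borel_measurable S \<Longrightarrow> avg n g \<in> borel_measurable S"
  unfolding ergodic_average_def
  by (intro borel_measurable_divide_ennreal borel_measurable_sum T_pow_measurable borel_measurable_const)

lemma T_mono: "x \<in> space S \<Longrightarrow> (\<And>y. y \<in> space S \<Longrightarrow> g y \<le> h y) \<Longrightarrow> T g x \<le> T h x"
  unfolding transfer_def by (intro nn_integral_mono) (auto simp: space_K)

lemma T_cong: "x \<in> space S \<Longrightarrow> (\<And>y. y \<in> space S \<Longrightarrow> g y = h y) \<Longrightarrow> T g x = T h x"
  unfolding transfer_def by (intro nn_integral_cong) (auto simp: space_K)

lemma T_add:
  "x \<in> space S \<Longrightarrow> g \<in> borel_measurable S \<Longrightarrow> h \<in> borel_measurable S \<Longrightarrow>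
    T (\<lambda>y. g y + h y) x = T g x + T h x"
  unfolding transfer_def by (intro nn_integral_add) (auto simp: measurable_K)

lemma T_cmult:
  "x \<in> space S \<Longrightarrow> g \<in> borel_measurable S \<Longrightarrow> T (\<lambda>y. c * g y) x = c * T g x"
  unfolding transfer_def by (intro nn_integral_cmult) (auto simp: measurable_K)

lemma T_divide:
  "x \<in> space S \<Longrightarrow> g \<in> borel_measurable S \<Longrightarrow> T (\<lambda>y. g y / c) x = T g x / c"
  using T_cmult[of x g "inverse c"] by (simp add: divide_ennreal_def mult.commute)

lemma T_sum:
  "x \<in> space S \<Longrightarrow> (\<And>i. i \<in> I \<Longrightarrow> g i \<in> borel_measurable S) \<Longrightarrow>
    T (\<lambda>y. \<Sum>i\<in>I. g i y) x = (\<Sum>i\<in>I. T (g i) x)"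
  unfolding transfer_def by (intro nn_integral_sum) (auto simp: measurable_K)

lemma T_const [simp]: "x \<in> space S \<Longrightarrow> T (\<lambda>_. c) x = c"
  unfolding transfer_def
  by (simp add: prob_space.emeasure_space_1[OF prob_space_K])

lemma T_pow_mono:
  "x \<in> space S \<Longrightarrow> (\<And>y. y \<in> space S \<Longrightarrow> g y \<le> h y) \<Longrightarrow> (T ^^ n) g x \<le> (T ^^ n) h x"
  by (induction n arbitrary: x) (auto intro!: T_mono)

lemma T_pow_cong:
  "x \<in> space S \<Longrightarrow> (\<And>y. y \<in> space S \<Longrightarrow> g y = h y) \<Longrightarrow> (T ^^ n) g x = (T ^^ n) h x"
  by (intro antisym T_pow_mono) auto

lemma T_pow_add:
  assumes [measurable]: "g \<in> borel_measurable S" "h \<in> borel_measurable S" and "x \<in> space S"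
  shows "(T ^^ n) (\<lambda>y. g y + h y) x = (T ^^ n) g x + (T ^^ n) h x"
  using assms(3)
proof (induction n arbitrary: x)
  case (Suc n)
  have "(T ^^ Suc n) (\<lambda>y. g y + h y) x = T (\<lambda>y. (T ^^ n) g y + (T ^^ n) h y) x"
    using Suc by (auto intro!: T_cong)
  with Suc.prems show ?case by (simp add: T_add)
qed simp

lemma T_pow_cmult:
  assumes [measurable]: "g \<in> borel_measurable S" and "x \<in> space S"
  shows "(T ^^ n) (\<lambda>y. c * g y) x = c * (T ^^ n) g x"
  using assms(2)
proof (induction n arbitrary: x)
  case (Suc n)
  have "(T ^^ Suc n) (\<lambda>y. c * g y) x = T (\<lambda>y. c * (T ^^ n) g y) x"
    using Suc by (auto intro!: T_cong)
  with Suc.prems show ?case by (simp add: T_cmult)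
qed simp

lemma T_pow_const [simp]: "x \<in> space S \<Longrightarrow> (T ^^ n) (\<lambda>_. c) x = c"
proof (induction n arbitrary: x)
  case (Suc n)
  then have "(T ^^ Suc n) (\<lambda>_. c) x = T (\<lambda>_. c) x"
    by (auto intro!: T_cong simp del: T_const)
  with Suc.prems show ?case by simp
qed simp

lemma T_pow_le:
  "x \<in> space S \<Longrightarrow> (\<And>y. y \<in> space S \<Longrightarrow> g y \<le> c) \<Longrightarrow> (T ^^ n) g x \<le> c"
  using T_pow_mono[of x g "\<lambda>_. c" n] by simp

lemma avg_add:
  assumes [measurable]: "g \<in> borel_measurable S" "h \<in> borel_measurable S" and "x \<in> space S"
  shows "avg n (\<lambda>y. g y + h y) x = avg n g x + avg n h x"
  using assms(3) unfolding ergodic_average_def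
  by (simp add: T_pow_add sum.distrib divide_ennreal_def distrib_right)

lemma avg_mono:
  "x \<in> space S \<Longrightarrow> (\<And>y. y \<in> space S \<Longrightarrow> g y \<le> h y) \<Longrightarrow> avg n g x \<le> avg n h x"
  unfolding ergodic_average_def divide_ennreal_def
  by (intro mult_right_mono sum_mono T_pow_mono) auto

lemma avg_const: "x \<in> space S \<Longrightarrow> n \<ge> 1 \<Longrightarrow> avg n (\<lambda>_. c) x = c"
  unfolding ergodic_average_def
  by (simp add: mult_divide_eq_ennreal mult.commute[of "of_nat n"])

lemma avg_le:
  assumes "x \<in> space S" "\<And>y. y \<in> space S \<Longrightarrow> g y \<le> c" shows "avg n g x \<le> c"
proof (cases n)
  case 0
  then show ?thesis by (simp add: ergodic_average_def)
next
  case (Suc m)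
  then show ?thesis using avg_mono[of x g "\<lambda>_. c" n] assms by (simp add: avg_const)
qed

text \<open>Splitting off the summand \<open>l = 0\<close> leaves \<open>T\<close> of the shorter
  sum, but divided by \<open>n + 1\<close>; dividing by \<open>n\<close> instead enlarges it. The
  resulting bound is free of the factor \<open>n / (n + 1)\<close> and loses nothing in the
  limit.\<close>

lemma avg_Suc:
  assumes [measurable]: "g \<in> borel_measurable S" and "x \<in> space S" "n \<ge> 1"
  shows "avg (Suc n) g x \<le> g x / of_nat (Suc n) + T (avg n g) x"
proof -
  have "T (avg n g) x = (\<Sum>l<n. (T ^^ Suc l) g x) / of_nat n"
    unfolding ergodic_average_def using assms by (simp add: T_divide T_sum)
  moreover have "avg (Suc n) g x = g x / of_nat (Suc n) + (\<Sum>l<n. (T ^^ Suc l) g x) / of_nat (Suc n)"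
    unfolding ergodic_average_def divide_ennreal_def
    by (subst sum.lessThan_Suc_shift) (simp add: distrib_right)
  moreover have "(\<Sum>l<n. (T ^^ Suc l) g x) / of_nat (Suc n) \<le> (\<Sum>l<n. (T ^^ Suc l) g x) / of_nat n"
    using \<open>n \<ge> 1\<close> unfolding divide_ennreal_def
    by (intro mult_left_mono) (auto simp: ennreal_of_nat_eq_real_of_nat inverse_ennreal
        simp del: of_nat_Suc intro!: ennreal_leI le_imp_inverse_le)
  ultimately show ?thesis by simp
qed

end

section \<open>The maximal inequality\<close>

text \<open>A dominating substitute for the maximum over \<open>k \<le> n\<close> of \<open>g + T g + \<dots> + T\<^sup>k\<^sup>-\<^sup>1 g - k e\<close> and \<open>0\<close>
  in Hopf's inequality: subtraction on \<^typ>\<open>ennreal\<close> truncates at \<open>0\<close>, so the recursion takes positive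
  parts by itself.\<close>

primrec excess ::
    "('s \<Rightarrow> 's measure) \<Rightarrow> ('s \<Rightarrow> ennreal) \<Rightarrow> ennreal \<Rightarrow> nat \<Rightarrow> 's \<Rightarrow> ennreal" where
  "excess K g e 0 = (\<lambda>_. 0)"
| "excess K g e (Suc n) = (\<lambda>x. g x + transfer K (excess K g e n) x - e)"

lemma ennreal_diff_posD: "0 < a - e \<Longrightarrow> e \<le> (a::ennreal)"
  by (cases a; cases e) (auto simp: ennreal_minus_if ennreal_less_iff split: if_splits)

lemma ennreal_le_diff_add: "a \<le> a - e + (e::ennreal)"
  by (cases a; cases e) (auto simp: ennreal_minus_if add_top simp flip: ennreal_plus)

locale stationary_kernel = transition_kernel S K for S :: "'s measure" and K +
  fixes \<nu> :: "'s measure"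
  assumes invariant: "invariant_distribution S K \<nu>"
begin

sublocale \<nu>: prob_space \<nu>
  using invariant by (simp add: invariant_distribution_def)

lemma sets_\<nu> [measurable_cong, simp]: "sets \<nu> = sets S"
  using invariant by (simp add: invariant_distribution_def)

lemma space_\<nu> [simp]: "space \<nu> = space S"
  using sets_\<nu> by (rule sets_eq_imp_space_eq)

lemma measurable_\<nu> [simp]: "measurable \<nu> N = measurable S N"
  by (intro measurable_cong_sets) auto

lemma nn_integral_T: 
  assumes [measurable]: "g \<in> borel_measurable S"
  shows "(\<integral>\<^sup>+x. T g x \<partial>\<nu>) = (\<integral>\<^sup>+x. g x \<partial>\<nu>)"
proof -
  have "(\<integral>\<^sup>+x. g x \<partial>\<nu>) = (\<integral>\<^sup>+x. g x \<partial>(\<nu> \<bind> K))"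
    using invariant by (simp add: invariant_distribution_def)
  also have "\<dots> = (\<integral>\<^sup>+x. T g x \<partial>\<nu>)"
    unfolding transfer_def by (intro nn_integral_bind[where B=S]) auto
  finally show ?thesis ..
qed

lemma nn_integral_T_pow: 
  "g \<in> borel_measurable S \<Longrightarrow> (\<integral>\<^sup>+x. (T ^^ n) g x \<partial>\<nu>) = (\<integral>\<^sup>+x. g x \<partial>\<nu>)"
proof (induction n)
  case (Suc n)
  then show ?case using nn_integral_T[of "(T ^^ n) g"] by simp
qed simp

lemma excess_measurable [measurable (raw)]:
  "g \<in> borel_measurable S \<Longrightarrow> excess K g e n \<in> borel_measurable S"
  by (induction n) auto

lemma excess_mono: "x \<in> space S \<Longrightarrow> excess K g e n x \<le> excess K g e (Suc n) x"
proof (induction n arbitrary: x)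
  case (Suc n)
  then show ?case
    by (auto intro!: ennreal_minus_mono add_left_mono T_mono simp del: excess.simps(2)
        simp: excess.simps(2)[of _ _ _ n] excess.simps(2)[of _ _ _ "Suc n"])
qed simp

text \<open>Each level of the recursion removes at most \<open>e\<close>, because the subtraction is
  truncated. Hence a partial sum above \<open>n e\<close> forces a positive excess, which is how the
  averages enter the maximal inequality.\<close>

lemma sum_le_excess:
  assumes [measurable]: "g \<in> borel_measurable S" and "x \<in> space S"
  shows "(\<Sum>l<n. (T ^^ l) g x) \<le> excess K g e n x + of_nat n * e"
  using assms(2)
proof (induction n arbitrary: x)
  case (Suc n)
  have "(\<Sum>l<Suc n. (T ^^ l) g x) = g x + T (\<lambda>y. \<Sum>l<n. (T ^^ l) g y) x"
    using Suc.prems by (subst sum.lessThan_Suc_shift) (simp add: T_sum)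
  also have "\<dots> \<le> g x + T (\<lambda>y. excess K g e n y + of_nat n * e) x"
    using Suc by (intro add_left_mono T_mono) auto
  also have "\<dots> = (g x + T (excess K g e n) x) + of_nat n * e"
    using Suc.prems by (simp add: T_add add.assoc)
  also have "\<dots> \<le> ((g x + T (excess K g e n) x - e) + e) + of_nat n * e"
    by (intro add_right_mono ennreal_le_diff_add)
  finally show ?case by (simp add: algebra_simps)
qed simp

text \<open>A crude bound whose purpose is finiteness, so that the integral of the excess can be
  cancelled in the next lemma.\<close>

lemma nn_integral_excess_le:
  assumes [measurable]: "g \<in> borel_measurable S"
  shows "(\<integral>\<^sup>+x. excess K g e n x \<partial>\<nu>) \<le> of_nat n * (\<integral>\<^sup>+x. g x \<partial>\<nu>)"
proof (induction n)
  case (Suc n)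
  have "(\<integral>\<^sup>+x. excess K g e (Suc n) x \<partial>\<nu>) \<le> (\<integral>\<^sup>+x. g x + T (excess K g e n) x \<partial>\<nu>)"
    by (intro nn_integral_mono) (simp add: diff_le_self_ennreal)
  also have "\<dots> = (\<integral>\<^sup>+x. g x \<partial>\<nu>) + (\<integral>\<^sup>+x. excess K g e n x \<partial>\<nu>)"
    by (simp add: nn_integral_add nn_integral_T)
  also have "\<dots> \<le> (\<integral>\<^sup>+x. g x \<partial>\<nu>) + of_nat n * (\<integral>\<^sup>+x. g x \<partial>\<nu>)"
    by (intro add_left_mono Suc)
  finally show ?case by (simp add: algebra_simps)
qed simp

text \<open>Hopf's argument: where the excess is positive its subtraction was not truncated, so
  \<open>e\<close> plus the excess equals \<open>g\<close> plus \<open>T\<close> of the previous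
  excess; elsewhere the excess vanishes. Integration, invariance and monotonicity in
  \<open>n\<close> put the same finite integral on both sides, where it cancels.\<close>

lemma emeasure_excess_pos:
  assumes [measurable]: "g \<in> borel_measurable S"
  shows "e * emeasure \<nu> {x\<in>space S. 0 < excess K g e n x} \<le> (\<integral>\<^sup>+x. g x \<partial>\<nu>)"
proof (cases "n = 0 \<or> (\<integral>\<^sup>+x. g x \<partial>\<nu>) = \<infinity>")
  \<comment> \<open>In the other case the set is empty or the bound is infinite.\<close>
  case False
  then obtain m where m: "n = Suc m" by (cases n) auto
  define E where "E = {x\<in>space S. 0 < excess K g e n x}"
  have [measurable]: "E \<in> sets S" unfolding E_def by measurable
  have fin: "(\<integral>\<^sup>+x. excess K g e k x \<partial>\<nu>) \<noteq> \<top>" for k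
    using nn_integral_excess_le[of g e k] False
    by (auto simp: top_unique ennreal_mult_eq_top_iff)
  have "e * emeasure \<nu> E + (\<integral>\<^sup>+x. excess K g e n x \<partial>\<nu>)
      = (\<integral>\<^sup>+x. e * indicator E x + excess K g e n x \<partial>\<nu>)"
    by (subst nn_integral_add) (auto simp: nn_integral_cmult_indicator)
  also have "\<dots> \<le> (\<integral>\<^sup>+x. g x + T (excess K g e m) x \<partial>\<nu>)"
  proof (rule nn_integral_mono)
    fix x assume "x \<in> space \<nu>"
    show "e * indicator E x + excess K g e n x \<le> g x + T (excess K g e m) x"
    proof (cases "x \<in> E")
      case True
      then have "e \<le> g x + T (excess K g e m) x"
        by (auto simp: E_def m dest: ennreal_diff_posD)
      then show ?thesis using True by (simp add: m add_diff_inverse_ennreal)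
    qed (use \<open>x \<in> space \<nu>\<close> in \<open>auto simp: E_def\<close>)
  qed
  also have "\<dots> = (\<integral>\<^sup>+x. g x \<partial>\<nu>) + (\<integral>\<^sup>+x. excess K g e m x \<partial>\<nu>)"
    by (simp add: nn_integral_add nn_integral_T)
  also have "\<dots> \<le> (\<integral>\<^sup>+x. g x \<partial>\<nu>) + (\<integral>\<^sup>+x. excess K g e n x \<partial>\<nu>)"
    unfolding m by (intro add_left_mono nn_integral_mono excess_mono) simp
  finally show ?thesis
    using fin[of n] unfolding E_def[symmetric]
    by (subst (asm) (1 2) add.commute) (simp add: ennreal_add_left_cancel_le)
qed auto

text \<open>The sets of positive excess increase with \<open>n\<close>, so the bound, which is
  uniform in \<open>n\<close>, passes to their union by continuity from below.\<close>

lemma maximal_inequality: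
  assumes [measurable]: "g \<in> borel_measurable S"
  shows "e * emeasure \<nu> {x\<in>space S. \<exists>n\<ge>1. e < avg n g x} \<le> (\<integral>\<^sup>+x. g x \<partial>\<nu>)"
proof -
  define E where "E n = {x\<in>space S. 0 < excess K g e n x}" for n
  have [measurable]: "E n \<in> sets S" for n unfolding E_def by measurable
  have "incseq E"
    unfolding E_def by (intro incseq_SucI) (auto dest: less_le_trans[OF _ excess_mono] simp del: excess.simps)
  have "{x\<in>space S. \<exists>n\<ge>1. e < avg n g x} \<subseteq> (\<Union>n. E n)"
  proof safe
    fix x n assume x: "x \<in> space S" and n: "1 \<le> (n::nat)" and e: "e < avg n g x"
    have "e * of_nat n < (\<Sum>l<n. (T ^^ l) g x)"
    proof (rule ccontr)
      assume "\<not> e * of_nat n < (\<Sum>l<n. (T ^^ l) g x)"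
      then have "avg n g x \<le> e * of_nat n / of_nat n"
        unfolding ergodic_average_def by (intro divide_right_mono_ennreal) auto
      also have "\<dots> = e" using n by (simp add: mult_divide_eq_ennreal)
      finally show False using e by simp
    qed
    also have "\<dots> \<le> excess K g e n x + of_nat n * e"
      by (rule sum_le_excess) (use x in auto)
    finally have "0 < excess K g e n x"
      by (auto simp: mult.commute zero_less_iff_neq_zero)
    with x show "x \<in> (\<Union>n. E n)" by (auto simp: E_def)
  qed
  then have "e * emeasure \<nu> {x\<in>space S. \<exists>n\<ge>1. e < avg n g x} \<le> e * emeasure \<nu> (\<Union>n. E n)"
    by (intro mult_left_mono emeasure_mono) auto
  also have "\<dots> = (SUP n. e * emeasure \<nu> (E n))"
    by (subst SUP_emeasure_incseq[symmetric]) (auto simp: \<open>incseq E\<close> SUP_mult_left_ennreal)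
  also have "\<dots> \<le> (\<integral>\<^sup>+x. g x \<partial>\<nu>)"
    unfolding E_def by (intro SUP_least emeasure_excess_pos) auto
  finally show ?thesis .
qed

end

lemma limsup_add_vanishing:
  fixes a b :: "nat \<Rightarrow> ennreal"
  assumes "a \<longlonglongrightarrow> 0"
  shows "limsup (\<lambda>n. a n + b n) \<le> limsup b"
proof (rule ennreal_le_epsilon)
  fix e :: real assume "0 < e"
  with assms have "eventually (\<lambda>n. a n < ennreal e) sequentially"
    by (intro order_tendstoD) auto
  then have "limsup (\<lambda>n. a n + b n) \<le> limsup (\<lambda>n. ennreal e + b n)"
    by (intro Limsup_mono) (auto elim!: eventually_mono)
  then show "limsup (\<lambda>n. a n + b n) \<le> limsup b + ennreal e"
    by (simp add: Limsup_const_add add.commute)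
qed

lemma tendsto_const_divide_nat:
  fixes c :: ennreal
  assumes "c < \<top>" shows "(\<lambda>n. c / of_nat (Suc n)) \<longlonglongrightarrow> 0"
proof -
  obtain r where r: "c = ennreal r" "0 \<le> r" using assms by (cases c) auto
  have "(\<lambda>n. ennreal (r / real (Suc n))) \<longlonglongrightarrow> ennreal 0"
    by (intro tendsto_ennrealI) (intro LIMSEQ_Suc[OF lim_const_over_n])
  moreover have "c / of_nat (Suc n) = ennreal (r / real (Suc n))" for n
    unfolding r ennreal_of_nat_eq_real_of_nat using r(2) by (intro divide_ennreal) auto
  ultimately show ?thesis by simp
qed

section \<open>Upper limits of averages of bounded functions\<close>

context transition_kernel
begin

text \<open>This is the limit of \<open>avg_Suc\<close>: the first summand is at most
  \<open>B / (n + 1)\<close> and vanishes, and the interchange of upper limit and integral is the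
  reverse Fatou lemma with the constant \<open>B\<close> as integrable majorant.\<close>

lemma limsup_avg_subharmonic:
  assumes [measurable]: "g \<in> borel_measurable S"
    and bd: "\<And>y. y \<in> space S \<Longrightarrow> g y \<le> B" "B < \<top>" and x: "x \<in> space S"
  shows "limsup (\<lambda>n. avg n g x) \<le> T (\<lambda>y. limsup (\<lambda>n. avg n g y)) x"
proof -
  have "limsup (\<lambda>n. avg n g x) = limsup (\<lambda>n. avg (Suc n) g x)"
    using limsup_shift[of "\<lambda>n. avg n g x"] by simp
  also have "\<dots> \<le> limsup (\<lambda>n. B / of_nat (Suc n) + T (avg n g) x)"
  proof (rule Limsup_mono, rule eventually_sequentiallyI)
    fix n :: nat assume "1 \<le> n"
    then have "avg (Suc n) g x \<le> g x / of_nat (Suc n) + T (avg n g) x"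
      using x by (intro avg_Suc) auto
    also have "\<dots> \<le> B / of_nat (Suc n) + T (avg n g) x"
      using bd x by (intro add_right_mono divide_right_mono_ennreal) auto
    finally show "avg (Suc n) g x \<le> B / of_nat (Suc n) + T (avg n g) x" .
  qed
  also have "\<dots> \<le> limsup (\<lambda>n. T (avg n g) x)"
    using bd(2) by (intro limsup_add_vanishing tendsto_const_divide_nat)
  also have "\<dots> \<le> T (\<lambda>y. limsup (\<lambda>n. avg n g y)) x"
    unfolding transfer_def
  proof (rule nn_integral_limsup[where w="\<lambda>_. B"])
    show "avg i g \<in> borel_measurable (K x)" for i
      using x by (simp add: measurable_K avg_measurable)
    show "AE y in K x. avg i g y \<le> B" for i
      using x bd by (intro AE_I2 avg_le) (auto simp: space_K)
    show "(\<integral>\<^sup>+y. B \<partial>K x) < \<infinity>"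
      using x bd by (simp add: prob_space.emeasure_space_1[OF prob_space_K])
  qed auto
  finally show ?thesis .
qed

end

section \<open>The pointwise ergodic theorem\<close>

text \<open>Invariance gives \<open>v\<close> and \<open>T v\<close> the same integral, so this
  turns a pointwise inequality \<open>v \<le> T v\<close> into an equality almost everywhere. It
  serves for \<nu> and also for the transition probabilities \<open>K x\<close>.\<close>

lemma nn_integral_eq_imp_AE_eq:
  assumes [measurable]: "f \<in> borel_measurable M" "g \<in> borel_measurable M"
    and le: "\<And>x. x \<in> space M \<Longrightarrow> f x \<le> g x"
    and eq: "(\<integral>\<^sup>+x. g x \<partial>M) = (\<integral>\<^sup>+x. f x \<partial>M)" and fin: "(\<integral>\<^sup>+x. f x \<partial>M) \<noteq> \<top>"
  shows "AE x in M. f x = g x"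
proof -
  have "(\<integral>\<^sup>+x. g x - f x \<partial>M) = (\<integral>\<^sup>+x. g x \<partial>M) - (\<integral>\<^sup>+x. f x \<partial>M)"
    using fin le by (intro nn_integral_diff) auto
  also have "\<dots> = 0" using eq fin by (simp add: less_top)
  finally have "AE x in M. g x - f x = 0"
    by (subst (asm) nn_integral_0_iff_AE) auto
  then show ?thesis
    using AE_space by eventually_elim (auto dest!: ennreal_minus_eq_0 intro: antisym le)
qed

text \<open>When two sequences have a constant finite sum, an upper bound for one is a lower bound
  for the other. This is why upper limits suffice for bounded functions.\<close>

lemma tendsto_complementary:
  fixes a b :: "nat \<Rightarrow> ennreal"
  assumes a: "limsup a \<le> m" and b: "limsup b \<le> m'" and fin: "m + m' < \<top>"
    and sum: "eventually (\<lambda>n. a n + b n = m + m') sequentially"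
  shows "a \<longlonglongrightarrow> m"
proof -
  have "m \<le> liminf a"
    unfolding le_Liminf_iff
  proof safe
    fix y assume y: "y < m"
    \<comment> \<open>If \<open>a n \<le> y\<close>, the constant sum forces \<open>b n\<close> up
      to at least \<open>m' + (m - y)\<close>, which the bound on the upper limit of
      \<open>b\<close> eventually excludes.\<close>
    have "m' < m' + (m - y)"
      using fin y by (simp add: less_top ennreal_add_eq_top diff_gr0_ennreal)
    with b have "eventually (\<lambda>n. b n < m' + (m - y)) sequentially"
      by (intro Limsup_lessD) (rule le_less_trans)
    with sum show "eventually (\<lambda>n. y < a n) sequentially"
    proof eventually_elim
      case (elim n)
      show ?case
      proof (rule ccontr)
        assume "\<not> y < a n"
        then have "a n + b n \<le> y + b n" by (intro add_right_mono) auto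
        also have "\<dots> < y + (m' + (m - y))"
          using elim y by (subst ennreal_add_left_cancel_less) auto
        also have "\<dots> = m + m'"
          using y by (metis add.assoc add.commute add_diff_inverse_ennreal less_imp_le)
        finally show False using elim by simp
      qed
    qed
  qed
  moreover have "liminf a \<le> limsup a" by (intro Liminf_le_Limsup) simp
  ultimately show ?thesis
    using a by (auto simp: tendsto_iff_Liminf_eq_Limsup intro: antisym order_trans)
qed

context transition_kernel
begin

lemma T_indicator_eq_0_iff:
  assumes "x \<in> space S" "A \<in> sets S"
  shows "T (indicator A) x = 0 \<longleftrightarrow> (AE y in K x. y \<notin> A)"
  unfolding transfer_def using assms
  by (subst nn_integral_0_iff_AE) (auto simp: measurable_K indicator_eq_0_iff)

lemma limsup_avg_le:
  "x \<in> space S \<Longrightarrow> (\<And>y. y \<in> space S \<Longrightarrow> g y \<le> B) \<Longrightarrow> limsup (\<lambda>n. avg n g x) \<le> B"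
  by (intro Limsup_bounded always_eventually allI avg_le)

end

text \<open>The path-space condition in the definition of irreducibility is restated with powers of
  the operator, so that the ergodic theorem is independent of the construction of the path measure.
  The translation is \<open>positive_harris_harris_kernel\<close>.\<close>

locale irreducible_stationary_kernel = stationary_kernel S K \<nu>
  for S :: "'s measure" and K \<nu> +
  fixes \<psi> :: "'s measure"
  assumes sets_\<psi>: "sets \<psi> = sets S" and \<psi>_nonzero: "emeasure \<psi> (space S) \<noteq> 0"
    and irreducible: "\<And>x A. x \<in> space S \<Longrightarrow> A \<in> sets S \<Longrightarrow> emeasure \<psi> A \<noteq> 0 \<Longrightarrow>
      \<exists>n. (T ^^ n) (indicator A) x \<noteq> 0"
begin

text \<open>\<open>leak x\<close> is the probability of leaving \<open>A\<close> in one step from a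
  point \<open>x\<close> of \<open>A\<close>. It vanishes almost everywhere, and by invariance so do
  its images under all powers of \<open>T\<close>. As \<open>A\<close> is not null, it contains a
  point from which no leak is ever met; from there the complement is never reached, so
  irreducibility makes it null for \<psi>.\<close>

lemma \<psi>_null_complement:
  assumes [measurable]: "A \<in> sets S" and A: "emeasure \<nu> A \<noteq> 0"
    and abs: "AE x in \<nu>. x \<in> A \<longrightarrow> (AE y in K x. y \<in> A)"
  shows "emeasure \<psi> (space S - A) = 0"
proof -
  define leak where "leak x = indicator A x * T (indicator (space S - A)) x" for x
  have [measurable]: "leak \<in> borel_measurable S" unfolding leak_def by measurable
  have "AE x in \<nu>. leak x = 0"
    using abs AE_space
    by eventually_elim (auto simp: leak_def indicator_def T_indicator_eq_0_iff)
  then have "(\<integral>\<^sup>+x. leak x \<partial>\<nu>) = 0"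
    by (subst nn_integral_0_iff_AE) auto
  then have "(\<integral>\<^sup>+x. (T ^^ n) leak x \<partial>\<nu>) = 0" for n
    by (simp add: nn_integral_T_pow)
  then have "AE x in \<nu>. (T ^^ n) leak x = 0" for n
    by (subst (asm) nn_integral_0_iff_AE) auto
  then have "AE x in \<nu>. \<forall>n. (T ^^ n) leak x = 0"
    by (simp add: AE_all_countable)
  moreover have "\<not> (AE x in \<nu>. x \<notin> A)"
    using A sets.sets_into_space[OF assms(1)] by (subst AE_iff_measurable[of A]) auto
  ultimately have "\<not> (\<forall>x. (\<forall>n. (T ^^ n) leak x = 0) \<longrightarrow> x \<notin> A)"
    by (metis (mono_tags, lifting) eventually_mono)
  then obtain x where x: "x \<in> A" "x \<in> space S" "\<And>n. (T ^^ n) leak x = 0"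
    using sets.sets_into_space[OF assms(1)] by auto
  \<comment> \<open>To be outside \<open>A\<close> at time \<open>n\<close>, the chain must have
    started outside or leaked at some time \<open>k < n\<close>; this is the union bound in operator
    form.\<close>
  have "(T ^^ n) (indicator (space S - A)) y
      \<le> indicator (space S - A) y + (\<Sum>k<n. (T ^^ k) leak y)" if "y \<in> space S" for n y
    using that
  proof (induction n arbitrary: y)
    case (Suc n)
    have "(T ^^ Suc n) (indicator (space S - A)) y
        \<le> T (\<lambda>y. indicator (space S - A) y + (\<Sum>k<n. (T ^^ k) leak y)) y"
      using Suc by (auto intro: T_mono)
    also have "\<dots> = T (indicator (space S - A)) y + (\<Sum>k<n. (T ^^ Suc k) leak y)"
      using Suc.prems by (simp add: T_add T_sum)
    also have "\<dots> \<le> (indicator (space S - A) y + leak y) + (\<Sum>k<n. (T ^^ Suc k) leak y)"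
    proof (rule add_right_mono, cases "y \<in> A")
      case False
      then show "T (indicator (space S - A)) y \<le> indicator (space S - A) y + leak y"
        using Suc.prems T_pow_le[of y "indicator (space S - A)" 1 1]
        by (auto simp: leak_def indicator_def)
    qed (simp add: leak_def)
    also have "\<dots> = indicator (space S - A) y + (\<Sum>k<Suc n. (T ^^ k) leak y)"
      by (subst sum.lessThan_Suc_shift) (simp add: add.assoc)
    finally show ?case .
  qed simp
  from this[OF x(2)] x have "(T ^^ n) (indicator (space S - A)) x = 0" for n
    by (metis (no_types, lifting) DiffE add_0 indicator_simps(2) le_zero_eq sum.neutral)
  then show ?thesis
    using irreducible[OF x(2), of "space S - A"] by auto
qed

text \<open>Both sets are absorbing up to null sets. If both had positive measure, both complements
  would be null for \<psi>; since \<open>a < b\<close>, these complements cover the space, which is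
  not null for \<psi>.\<close>

lemma limsup_avg_level_sets:
  assumes [measurable]: "g \<in> borel_measurable S"
    and bd: "\<And>y. y \<in> space S \<Longrightarrow> g y \<le> B" "B < \<top>" and ab: "a < b"
  defines "u \<equiv> \<lambda>x. limsup (\<lambda>n. avg n g x)"
  shows "emeasure \<nu> {x\<in>space S. u x \<le> a} = 0 \<or> emeasure \<nu> {x\<in>space S. b \<le> u x} = 0"
proof (rule ccontr)
  assume neg: "\<not> ?thesis"
  have u[measurable]: "u \<in> borel_measurable S" unfolding u_def by measurable
  have u_le: "u x \<le> B" if "x \<in> space S" for x
    unfolding u_def using that bd by (intro limsup_avg_le)
  have sub: "u x \<le> T u x" if "x \<in> space S" for x
    unfolding u_def using that bd by (intro limsup_avg_subharmonic) auto
  have Tu_fin: "T u x \<noteq> \<top>" if "x \<in> space S" for x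
    using T_pow_le[of x u B 1] u_le that bd by (auto simp: top_unique)
  \<comment> \<open>The maximum of a constant and a subharmonic function is again subharmonic, and
    invariance turns the inequality into an equality. Maxima are used because this one identity
    handles both level sets.\<close>
  have max_harmonic: "AE x in \<nu>. max c (u x) = T (\<lambda>y. max c (u y)) x" if "c < \<top>" for c
  proof (rule nn_integral_eq_imp_AE_eq)
    show "max c (u x) \<le> T (\<lambda>y. max c (u y)) x" if "x \<in> space \<nu>" for x
    proof (rule max.boundedI)
      show "c \<le> T (\<lambda>y. max c (u y)) x"
        using T_mono[of x "\<lambda>_. c"] that by simp
      show "u x \<le> T (\<lambda>y. max c (u y)) x"
        using that by (intro order_trans[OF sub T_mono]) auto
    qed
    have "(\<integral>\<^sup>+x. max c (u x) \<partial>\<nu>) \<le> (\<integral>\<^sup>+x. max c B \<partial>\<nu>)"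
      using u_le by (intro nn_integral_mono max.mono) auto
    also have "\<dots> = max c B" by (simp add: \<nu>.emeasure_space_1 del: space_\<nu>)
    also have "\<dots> < \<top>" using that bd by simp
    finally show "(\<integral>\<^sup>+x. max c (u x) \<partial>\<nu>) \<noteq> \<top>" by simp
  qed (simp_all add: nn_integral_T)
  have u_harmonic: "AE x in \<nu>. u x = T u x"
    using max_harmonic[of 0] by (simp add: max_def cong: if_cong)
  have "a < \<top>" using ab by (auto simp: less_top[symmetric])
  \<comment> \<open>The second level set is nonempty here, and at any of its points
    \<open>b \<le> u x \<le> B\<close>.\<close>
  have "b < \<top>"
  proof -
    have "{x\<in>space S. b \<le> u x} \<noteq> {}" using neg by (metis emeasure_empty)
    then obtain x where "x \<in> space S" "b \<le> u x" by auto
    with u_le[of x] bd(2) show ?thesis by (meson le_less_trans order_trans)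
  qed
  have "emeasure \<psi> (space S - {x\<in>space S. u x \<le> a}) = 0"
  proof (rule \<psi>_null_complement)
    show "AE x in \<nu>. x \<in> {x \<in> space S. u x \<le> a} \<longrightarrow> (AE y in K x. y \<in> {x \<in> space S. u x \<le> a})"
      using max_harmonic[OF \<open>a < \<top>\<close>] AE_space
    proof eventually_elim
      case (elim x)
      then have x: "x \<in> space S" by simp
      show ?case
      proof
        assume "x \<in> {x \<in> space S. u x \<le> a}"
        \<comment> \<open>At such an \<open>x\<close> the function \<open>max a u\<close>, which is
          nowhere below \<open>a\<close>, has mean exactly \<open>a\<close> under
          \<open>K x\<close>; hence it equals \<open>a\<close> almost surely.\<close>
        then have "T (\<lambda>y. max a (u y)) x = a" using elim by (simp add: max_absorb1)
        then have "AE y in K x. a = max a (u y)"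
          unfolding transfer_def using \<open>a < \<top>\<close> x
          by (intro nn_integral_eq_imp_AE_eq)
             (auto simp: measurable_K prob_space.emeasure_space_1[OF prob_space_K])
        then show "AE y in K x. y \<in> {x \<in> space S. u x \<le> a}"
          using AE_space by eventually_elim (auto simp: space_K[OF x] max_def split: if_splits)
      qed
    qed
  qed (use neg in auto)
  moreover have "emeasure \<psi> (space S - {x\<in>space S. b \<le> u x}) = 0"
  proof (rule \<psi>_null_complement)
    show "AE x in \<nu>. x \<in> {x \<in> space S. b \<le> u x} \<longrightarrow> (AE y in K x. y \<in> {x \<in> space S. b \<le> u x})"
      using max_harmonic[OF \<open>b < \<top>\<close>] u_harmonic AE_space
    proof eventually_elim
      case (elim x)
      then have x: "x \<in> space S" by simp
      show ?case
      proof
        assume "x \<in> {x \<in> space S. b \<le> u x}"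
        \<comment> \<open>Here \<open>max b (u x) = u x = T u x\<close>, so \<open>u\<close> and the
          larger function \<open>max b u\<close> have the same finite mean under
          \<open>K x\<close>.\<close>
        then have "T (\<lambda>y. max b (u y)) x = T u x" using elim by (simp add: max_absorb2)
        then have "AE y in K x. u y = max b (u y)"
          using x Tu_fin[OF x] unfolding transfer_def
          by (intro nn_integral_eq_imp_AE_eq) (auto simp: measurable_K)
        then show "AE y in K x. y \<in> {x \<in> space S. b \<le> u x}"
          using AE_space by eventually_elim (auto simp: space_K[OF x] max_def split: if_splits)
      qed
    qed
  qed (use neg in auto)
  ultimately have "emeasure \<psi> ((space S - {x\<in>space S. u x \<le> a}) \<union> (space S - {x\<in>space S. b \<le> u x})) = 0"
    using emeasure_subadditive[of "space S - {x\<in>space S. u x \<le> a}" \<psi> "space S - {x\<in>space S. b \<le> u x}"]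
    by (simp add: sets_\<psi>)
  also have "(space S - {x\<in>space S. u x \<le> a}) \<union> (space S - {x\<in>space S. b \<le> u x}) = space S"
    using ab by auto
  finally show False using \<psi>_nonzero by simp
qed

text \<open>Just above the mean \<open>m\<close>, the level sets leave two possibilities. If
  \<open>u\<close> exceeded some \<open>a > m\<close> almost everywhere, then so would some average,
  and the maximal inequality would give \<open>a \<le> m\<close>. So \<open>u\<close> lies below
  every \<open>b > m\<close> almost everywhere.\<close>

lemma AE_limsup_avg_le:
  assumes [measurable]: "g \<in> borel_measurable S"
    and bd: "\<And>y. y \<in> space S \<Longrightarrow> g y \<le> B" "B < \<top>"
  shows "AE x in \<nu>. limsup (\<lambda>n. avg n g x) \<le> (\<integral>\<^sup>+x. g x \<partial>\<nu>)"
proof -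
  define m where "m = (\<integral>\<^sup>+x. g x \<partial>\<nu>)"
  define u where "u x = limsup (\<lambda>n. avg n g x)" for x
  have u[measurable]: "u \<in> borel_measurable S" unfolding u_def by measurable
  have "m \<le> (\<integral>\<^sup>+x. B \<partial>\<nu>)"
    unfolding m_def using bd by (intro nn_integral_mono) auto
  then have m: "m < \<top>"
    using bd by (simp add: \<nu>.emeasure_space_1 del: space_\<nu>)
  have "AE x in \<nu>. u x \<le> m + ennreal (1 / Suc k)" for k
  proof -
    \<comment> \<open>The choice only has to give \<open>m < a < b\<close> with \<open>b\<close>
      tending to \<open>m\<close> as \<open>k\<close> grows.\<close>
    define a where "a = m + ennreal (1 / Suc k / 2)"
    define b where "b = m + ennreal (1 / Suc k)"
    have "m < a" using m by (simp add: a_def less_top)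
    have "a < b"
      unfolding a_def b_def using m by (simp add: ennreal_add_left_cancel_less less_top ennreal_less_iff field_simps)
    consider "emeasure \<nu> {x\<in>space S. u x \<le> a} = 0" | "emeasure \<nu> {x\<in>space S. b \<le> u x} = 0"
      using limsup_avg_level_sets[of g B a b] bd \<open>a < b\<close> unfolding u_def by auto
    then show ?thesis
    proof cases
      case 1
      then have "AE x in \<nu>. \<not> u x \<le> a" by (subst AE_iff_measurable[OF _ refl]) auto
      then have "AE x in \<nu>. \<exists>n\<ge>1. a < avg n g x"
      proof eventually_elim
        case (elim x)
        show ?case
        proof (rule ccontr)
          assume "\<not> ?case"
          then have "eventually (\<lambda>n. avg n g x \<le> a) sequentially"
            by (auto simp: not_less intro!: eventually_sequentiallyI[of 1])
          then have "u x \<le> a" unfolding u_def by (rule Limsup_bounded)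
          with elim show False by simp
        qed
      qed
      then have "AE x in \<nu>. x \<in> {x\<in>space S. \<exists>n\<ge>1. a < avg n g x}"
        using AE_space by eventually_elim auto
      then have "emeasure \<nu> {x\<in>space S. \<exists>n\<ge>1. a < avg n g x} = 1"
        by (intro \<nu>.emeasure_eq_1_AE) auto
      then have "a \<le> m"
        using maximal_inequality[of g a] by (simp add: m_def)
      with \<open>m < a\<close> show ?thesis by simp
    next
      case 2
      then have "AE x in \<nu>. \<not> b \<le> u x" by (subst AE_iff_measurable[OF _ refl]) auto
      then show ?thesis by eventually_elim (auto simp: b_def)
    qed
  qed
  then have "AE x in \<nu>. \<forall>k. u x \<le> m + ennreal (1 / Suc k)"
    by (simp add: AE_all_countable)
  then show ?thesis
  proof eventually_elim
    case (elim x)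
    have "u x \<le> m"
    proof (rule ennreal_le_epsilon)
      fix e :: real assume "0 < e"
      then obtain k where "1 / real (Suc k) < e"
        using nat_approx_posE by blast
      then show "u x \<le> m + ennreal e"
        using elim[rule_format, of k] by (auto elim!: order_trans intro!: add_left_mono ennreal_leI)
    qed
    then show ?case by (simp add: u_def m_def)
  qed
qed

text \<open>For \<open>n \<ge> 1\<close> the averages of \<open>g\<close> and \<open>B - g\<close>
  add up to \<open>B\<close>. The statement is for a single point, so that it serves both
  convergence almost everywhere and, under Harris recurrence, convergence at every state.\<close>

lemma tendsto_avg_if_limsup_le:
  assumes [measurable]: "g \<in> borel_measurable S"
    and bd: "\<And>y. y \<in> space S \<Longrightarrow> g y \<le> B" "B < \<top>" and x: "x \<in> space S"
    and g: "limsup (\<lambda>n. avg n g x) \<le> (\<integral>\<^sup>+x. g x \<partial>\<nu>)"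
    and Bg: "limsup (\<lambda>n. avg n (\<lambda>y. B - g y) x) \<le> (\<integral>\<^sup>+x. B - g x \<partial>\<nu>)"
  shows "(\<lambda>n. avg n g x) \<longlonglongrightarrow> (\<integral>\<^sup>+x. g x \<partial>\<nu>)"
proof (rule tendsto_complementary[OF g Bg])
  have "(\<integral>\<^sup>+x. g x \<partial>\<nu>) + (\<integral>\<^sup>+x. B - g x \<partial>\<nu>) = (\<integral>\<^sup>+x. g x + (B - g x) \<partial>\<nu>)"
    by (intro nn_integral_add[symmetric]) auto
  also have "\<dots> = (\<integral>\<^sup>+x. B \<partial>\<nu>)"
    using bd by (intro nn_integral_cong) (auto simp: add_diff_inverse_ennreal)
  also have "\<dots> = B" by (simp add: \<nu>.emeasure_space_1 del: space_\<nu>)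
  finally have *: "(\<integral>\<^sup>+x. g x \<partial>\<nu>) + (\<integral>\<^sup>+x. B - g x \<partial>\<nu>) = B" .
  show "(\<integral>\<^sup>+x. g x \<partial>\<nu>) + (\<integral>\<^sup>+x. B - g x \<partial>\<nu>) < \<top>"
    unfolding * by fact
  have "avg n g x + avg n (\<lambda>y. B - g y) x = B" if "n \<ge> 1" for n
  proof -
    have "avg n g x + avg n (\<lambda>y. B - g y) x = avg n (\<lambda>y. g y + (B - g y)) x"
      using x by (intro avg_add[symmetric]) auto
    also have "\<dots> = avg n (\<lambda>_. B) x"
      using bd x by (intro antisym avg_mono) (auto simp: add_diff_inverse_ennreal)
    finally show ?thesis using avg_const x that by simp
  qed
  then show "eventually (\<lambda>n. avg n g x + avg n (\<lambda>y. B - g y) x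
      = (\<integral>\<^sup>+x. g x \<partial>\<nu>) + (\<integral>\<^sup>+x. B - g x \<partial>\<nu>)) sequentially"
    unfolding * by (intro eventually_sequentiallyI[of 1])
qed

lemma AE_tendsto_avg_bounded:
  assumes [measurable]: "g \<in> borel_measurable S"
    and bd: "\<And>y. y \<in> space S \<Longrightarrow> g y \<le> B" "B < \<top>"
  shows "AE x in \<nu>. (\<lambda>n. avg n g x) \<longlonglongrightarrow> (\<integral>\<^sup>+x. g x \<partial>\<nu>)"
proof -
  have "AE x in \<nu>. limsup (\<lambda>n. avg n (\<lambda>y. B - g y) x) \<le> (\<integral>\<^sup>+x. B - g x \<partial>\<nu>)"
    using bd by (intro AE_limsup_avg_le[where B=B]) (auto simp: diff_le_self_ennreal)
  moreover have "AE x in \<nu>. limsup (\<lambda>n. avg n g x) \<le> (\<integral>\<^sup>+x. g x \<partial>\<nu>)"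
    using bd by (intro AE_limsup_avg_le) auto
  ultimately show ?thesis
    using AE_space
    by eventually_elim (auto intro!: tendsto_avg_if_limsup_le[where B=B] bd)
qed

text \<open>The lower bound follows from the truncations \<open>g' B\<close> by monotonicity. For
  the upper bound the remainder \<open>g - g' B\<close> has a small integral when \<open>B\<close>
  is large, and the maximal inequality controls all its averages at once.\<close>

theorem AE_tendsto_avg:
  assumes [measurable]: "g \<in> borel_measurable S" and fin: "(\<integral>\<^sup>+x. g x \<partial>\<nu>) < \<top>"
  shows "AE x in \<nu>. (\<lambda>n. avg n g x) \<longlonglongrightarrow> (\<integral>\<^sup>+x. g x \<partial>\<nu>)"
proof -
  define m where "m = (\<integral>\<^sup>+x. g x \<partial>\<nu>)"
  define g' where "g' B y = min (g y) (of_nat B)" for B :: nat and y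
  define m' where "m' B = (\<integral>\<^sup>+x. g' B x \<partial>\<nu>)" for B
  have [measurable]: "g' B \<in> borel_measurable S" for B unfolding g'_def by measurable
  have g'_le: "g' B y \<le> g y" for B y by (simp add: g'_def)
  have m'_le: "m' B \<le> m" for B
    unfolding m_def m'_def by (intro nn_integral_mono g'_le)
  have "(SUP B. g' B x) = g x" for x
    unfolding g'_def inf_min[symmetric]
    by (simp add: inf_SUP[symmetric] ennreal_SUP_of_nat_eq_top)
  then have "m = (\<integral>\<^sup>+x. (SUP B. g' B x) \<partial>\<nu>)" by (simp add: m_def)
  also have "\<dots> = (SUP B. m' B)"
    unfolding m'_def
    by (intro nn_integral_monotone_convergence_SUP)
       (auto simp: g'_def incseq_def le_fun_def min_le_iff_disj)
  finally have m_SUP: "m = (SUP B. m' B)" .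
  have conv: "AE x in \<nu>. \<forall>B. (\<lambda>n. avg n (g' B) x) \<longlonglongrightarrow> m' B"
    unfolding AE_all_countable m'_def
  proof
    fix B show "AE x in \<nu>. (\<lambda>n. avg n (g' B) x) \<longlonglongrightarrow> (\<integral>\<^sup>+x. g' B x \<partial>\<nu>)"
      by (rule AE_tendsto_avg_bounded[of _ "of_nat B"]) (auto simp: g'_def of_nat_less_top)
  qed
  have upper: "AE x in \<nu>. limsup (\<lambda>n. avg n g x) \<le> m + ennreal (2 / Suc k)" for k
  proof -
    \<comment> \<open>One \<open>e\<close> is spent on the averages of the truncated function and
      one on those of the remainder, hence \<open>2 / Suc k\<close>.\<close>
    define e where "e = ennreal (1 / Suc k)"
    have e: "0 < e" "e < \<top>" "m + e + e = m + ennreal (2 / Suc k)"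
      by (auto simp: e_def add.assoc simp flip: ennreal_plus add_divide_distrib)
    define Z where "Z = {x\<in>space S. \<not> limsup (\<lambda>n. avg n g x) \<le> m + e + e}"
    have [measurable]: "Z \<in> sets S" unfolding Z_def by measurable
    \<comment> \<open>This is the additive form of bounding \<open>e\<close> times the measure of
      \<open>Z\<close> by \<open>m - m' B\<close>. Since \<open>Z\<close> does not depend on
      \<open>B\<close>, letting \<open>B\<close> grow forces \<open>Z\<close> to be null.\<close>
    have "e * emeasure \<nu> Z + m' B \<le> m" for B
    proof -
      have "AE x in \<nu>. x \<in> Z \<longrightarrow> (\<exists>n\<ge>1. e < avg n (\<lambda>y. g y - g' B y) x)"
        using conv AE_space
      proof eventually_elim
        case (elim x)
        show ?case
        proof (rule ccontr)
          assume *: "\<not> ?case"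
          then have x: "x \<in> space S" "x \<in> Z" by (auto simp: Z_def)
          from * have le: "avg n (\<lambda>y. g y - g' B y) x \<le> e" if "n \<ge> 1" for n
            using that by (auto simp: not_less)
          have "m' B < m + e"
            using m'_le[of B] e(1) fin by (intro le_less_trans[of "m' B" m]) (auto simp: m_def)
          then have "eventually (\<lambda>n. avg n (g' B) x < m + e) sequentially"
            using elim by (intro order_tendstoD(2)[of _ "m' B"]) auto
          then have "eventually (\<lambda>n. avg n g x \<le> m + e + e) sequentially"
            using eventually_ge_at_top[of 1]
          proof eventually_elim
            case (elim n)
            have "avg n g x = avg n (\<lambda>y. g' B y + (g y - g' B y)) x"
              using x by (intro antisym avg_mono) (auto simp: add_diff_inverse_ennreal g'_le)
            also have "\<dots> = avg n (g' B) x + avg n (\<lambda>y. g y - g' B y) x"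
              using x by (intro avg_add) auto
            also have "\<dots> \<le> (m + e) + e"
              using elim le by (intro add_mono) auto
            finally show ?case .
          qed
          then have "limsup (\<lambda>n. avg n g x) \<le> m + e + e" by (rule Limsup_bounded)
          with x show False by (simp add: Z_def)
        qed
      qed
      then have "emeasure \<nu> Z \<le> emeasure \<nu> {x\<in>space S. \<exists>n\<ge>1. e < avg n (\<lambda>y. g y - g' B y) x}"
        using AE_space by (intro emeasure_mono_AE) (auto elim!: eventually_elim2 simp: Z_def)
      then have "e * emeasure \<nu> Z \<le> (\<integral>\<^sup>+x. g x - g' B x \<partial>\<nu>)"
        using maximal_inequality[of "\<lambda>y. g y - g' B y" e]
        by (auto elim!: order_trans[rotated] intro!: mult_left_mono)
      then have "e * emeasure \<nu> Z + m' B \<le> (\<integral>\<^sup>+x. g x - g' B x \<partial>\<nu>) + (\<integral>\<^sup>+x. g' B x \<partial>\<nu>)"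
        unfolding m'_def by (rule add_right_mono)
      also have "\<dots> = (\<integral>\<^sup>+x. g x - g' B x + g' B x \<partial>\<nu>)"
        by (intro nn_integral_add[symmetric]) auto
      also have "\<dots> = m"
        unfolding m_def by (intro nn_integral_cong) (simp add: diff_add_cancel_ennreal g'_le)
      finally show ?thesis .
    qed
    then have "(SUP B. e * emeasure \<nu> Z + m' B) \<le> m" by (intro SUP_least)
    then have "e * emeasure \<nu> Z + m \<le> 0 + m"
      unfolding m_SUP by (simp add: ennreal_SUP_add_right)
    then have "e * emeasure \<nu> Z \<le> 0"
      using fin by (subst (asm) (1 2) add.commute) (auto simp: ennreal_add_left_cancel_le m_def)
    then have "emeasure \<nu> Z = 0" using e by auto
    then have "AE x in \<nu>. limsup (\<lambda>n. avg n g x) \<le> m + e + e"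
      by (subst AE_iff_measurable[OF _ refl]) (auto simp: Z_def)
    then show ?thesis by (simp add: e)
  qed
  then have "AE x in \<nu>. \<forall>k. limsup (\<lambda>n. avg n g x) \<le> m + ennreal (2 / Suc k)"
    by (simp add: AE_all_countable)
  with conv show ?thesis
    using AE_space
  proof eventually_elim
    case (elim x)
    have "limsup (\<lambda>n. avg n g x) \<le> m"
    proof (rule ennreal_le_epsilon)
      fix r :: real assume "0 < r"
      then obtain k where "1 / real (Suc k) < r / 2"
        using nat_approx_posE[of "r / 2"] by auto
      then have "ennreal (2 / Suc k) \<le> ennreal r" by (intro ennreal_leI) simp
      then show "limsup (\<lambda>n. avg n g x) \<le> m + ennreal r"
        using elim(2)[rule_format, of k] by (auto elim!: order_trans intro!: add_left_mono)
    qed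
    moreover have "m \<le> liminf (\<lambda>n. avg n g x)"
      unfolding m_SUP
    proof (rule SUP_least)
      fix B
      have "m' B = liminf (\<lambda>n. avg n (g' B) x)"
        using elim(1) by (intro lim_imp_Liminf[symmetric]) auto
      also have "\<dots> \<le> liminf (\<lambda>n. avg n g x)"
        using elim(3) by (intro Liminf_mono always_eventually allI avg_mono g'_le) auto
      finally show "m' B \<le> liminf (\<lambda>n. avg n g x)" .
    qed
    moreover have "liminf (\<lambda>n. avg n g x) \<le> limsup (\<lambda>n. avg n g x)"
      by (intro Liminf_le_Limsup) simp
    ultimately show ?case
      unfolding m_def[symmetric]
      by (auto simp: tendsto_iff_Liminf_eq_Limsup intro: antisym order_trans)
  qed
qed

end

section \<open>Bounded functions and Harris recurrence\<close>

text \<open>The probability, from \<open>y\<close>, of being outside \<open>A\<close> at all times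
  \<open>0\<close> to \<open>k\<close>, written with iterates of the kernel killed on
  \<open>A\<close> so that recurrence can be expressed without the path measure.\<close>

definition avoid ::
    "'s measure \<Rightarrow> ('s \<Rightarrow> 's measure) \<Rightarrow> 's set \<Rightarrow> nat \<Rightarrow> 's \<Rightarrow> ennreal" where
  "avoid S K A k =
     ((\<lambda>h y. indicator (space S - A) y * transfer K h y) ^^ k) (indicator (space S - A))"

lemma (in transition_kernel) avoid_measurable [measurable (raw)]:
  "A \<in> sets S \<Longrightarrow> avoid S K A k \<in> borel_measurable S"
  unfolding avoid_def by (induction k) auto

text \<open>By \<open>emeasure_avoid\<close> the vanishing quantity is the probability of no visit
  to \<open>A\<close> during the times \<open>m\<close> to \<open>m + k\<close>. As in the
  definition of Harris recurrence the start lies in \<open>A\<close>, so the set to be revisited has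
  to be chosen around the given state.\<close>

locale harris_kernel = irreducible_stationary_kernel +
  assumes avoid_vanishes: "\<And>A x m. A \<in> sets S \<Longrightarrow> emeasure \<psi> A \<noteq> 0 \<Longrightarrow> x \<in> A \<Longrightarrow>
    (\<lambda>k. (T ^^ m) (avoid S K A k) x) \<longlonglongrightarrow> 0"
begin

text \<open>The set \<open>Z\<close> of states from which \<open>N\<close> can be reached is null
  and has an absorbing complement. Recurrence does not apply to that complement directly, since a
  start in \<open>Z\<close> lies outside it. Instead let \<open>h\<close> be the probability of
  remaining in \<open>Z\<close> forever, a harmonic function, and put \<open>c = h x\<close>. The
  set where \<open>h \<le> c\<close> contains \<open>x\<close> and every state outside
  \<open>Z\<close>, so it is revisited from \<open>x\<close>. Stopping at a visit after time
  \<open>m\<close> gives \<open>c \<le> c * q m x\<close>, in the limit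
  \<open>c \<le> c * c\<close>, and \<open>c < 1\<close> leaves only \<open>c = 0\<close>.\<close>

lemma T_pow_null_vanishes:
  assumes [measurable]: "N \<in> sets S" and N: "emeasure \<nu> N = 0" and x: "x \<in> space S"
  shows "(\<lambda>n. (T ^^ n) (indicator N) x) \<longlonglongrightarrow> 0"
proof -
  \<comment> \<open>The value \<open>n = 0\<close> is included, which puts \<open>N\<close> inside
    \<open>Z\<close>.\<close>
  define Z where "Z = {y\<in>space S. \<exists>n. (T ^^ n) (indicator N) y \<noteq> 0}"
  have [measurable]: "Z \<in> sets S" unfolding Z_def by measurable
  have Z_sub: "Z \<subseteq> space S" by (auto simp: Z_def)
  have "(\<integral>\<^sup>+y. (T ^^ n) (indicator N) y \<partial>\<nu>) = 0" for n
    using N by (simp add: nn_integral_T_pow)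
  then have "AE y in \<nu>. (T ^^ n) (indicator N) y = 0" for n
    by (subst (asm) nn_integral_0_iff_AE) auto
  then have "AE y in \<nu>. \<forall>n. (T ^^ n) (indicator N) y = 0"
    by (simp add: AE_all_countable)
  then have "AE y in \<nu>. y \<in> space S - Z"
    using AE_space by eventually_elim (auto simp: Z_def)
  then have "emeasure \<nu> (space S - Z) = 1"
    by (intro \<nu>.emeasure_eq_1_AE) auto
  moreover have absorbing: "T (indicator Z) y = 0" if y: "y \<in> space S - Z" for y
  proof -
    have "(\<integral>\<^sup>+z. (T ^^ n) (indicator N) z \<partial>K y) = 0" for n
      using y by (subst transfer_def[symmetric]) (auto simp: Z_def dest: spec[of _ "Suc n"])
    then have "AE z in K y. (T ^^ n) (indicator N) z = 0" for n
      using y by (subst (asm) nn_integral_0_iff_AE) (auto simp: measurable_K)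
    then have "AE z in K y. \<forall>n. (T ^^ n) (indicator N) z = 0"
      by (simp add: AE_all_countable)
    then have "AE z in K y. z \<notin> Z"
      by eventually_elim (auto simp: Z_def)
    with y show ?thesis by (subst T_indicator_eq_0_iff) auto
  qed
  moreover have "AE y in K x. y \<in> space S - Z" if "x \<in> space S - Z" for x
    using absorbing[OF that] that AE_space[of "K x"]
    by (subst (asm) T_indicator_eq_0_iff) (auto simp: space_K elim: eventually_elim2)
  ultimately have "emeasure \<psi> (space S - (space S - Z)) = 0"
    by (intro \<psi>_null_complement) auto
  then have \<psi>_Z: "emeasure \<psi> Z = 0"
    using Z_sub by (simp add: double_diff)
  define q where "q n = (T ^^ n) (indicator Z)" for n
  have [measurable]: "q n \<in> borel_measurable S" for n unfolding q_def by measurable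
  have q_dec: "q (Suc n) y \<le> q n y" if "y \<in> space S" for n y
  proof -
    have "T (indicator Z) z \<le> indicator Z z" if "z \<in> space S" for z
    proof (cases "z \<in> Z")
      case True
      have "T (indicator Z) z \<le> T (\<lambda>_. 1) z"
        using that by (intro T_mono) (auto split: split_indicator)
      with True that show ?thesis by simp
    qed (use that absorbing[of z] in auto)
    then show ?thesis
      using that unfolding q_def by (subst funpow_Suc_right) (auto intro!: T_pow_mono)
  qed
  have q_le_1: "q n y \<le> 1" if "y \<in> space S" for n y
    unfolding q_def using that by (intro T_pow_le) (auto split: split_indicator)
  \<comment> \<open>The complement of \<open>Z\<close> is absorbing at each of its points, not
    merely almost everywhere; so \<open>q n\<close> decreases, and its limit is the probability of
    never leaving \<open>Z\<close>.\<close>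
  define h where "h y = (INF n. q n y)" for y
  have [measurable]: "h \<in> borel_measurable S" unfolding h_def by measurable
  have h_le: "h y \<le> q n y" for n y unfolding h_def by (rule INF_lower) simp
  have q_tendsto: "(\<lambda>n. q n y) \<longlonglongrightarrow> h y" if "y \<in> space S" for y
    unfolding h_def using q_dec that by (intro LIMSEQ_INF decseq_SucI)
  have harmonic: "T h y = h y" if y: "y \<in> space S" for y
  proof -
    have "(\<integral>\<^sup>+z. q 0 z \<partial>K y) \<le> (\<integral>\<^sup>+z. 1 \<partial>K y)"
      using y by (intro nn_integral_mono q_le_1) (simp add: space_K)
    also have "\<dots> < \<top>" using y by (simp add: prob_space.emeasure_space_1[OF prob_space_K])
    finally have "(\<integral>\<^sup>+z. (INF n. q n z) \<partial>K y) = (INF n. \<integral>\<^sup>+z. q n z \<partial>K y)"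
      using y by (intro nn_integral_monotone_convergence_INF_AE')
        (auto simp: measurable_K space_K intro!: AE_I2 q_dec)
    also have "\<dots> = (INF n. q (Suc n) y)" by (simp add: q_def transfer_def)
    also have "\<dots> = h y"
      using LIMSEQ_Suc[OF q_tendsto[OF y]] LIMSEQ_INF[of "\<lambda>n. q (Suc n) y"] y q_dec
      by (intro LIMSEQ_unique[where X="\<lambda>n. q (Suc n) y"]) (auto intro!: decseq_SucI)
    finally show ?thesis by (simp add: transfer_def h_def)
  qed
  have harmonic_pow: "(T ^^ m) h y = h y" if "y \<in> space S" for m y
    using that
  proof (induction m arbitrary: y)
    case (Suc m)
    then have "(T ^^ Suc m) h y = T h y" by (auto intro!: T_cong)
    also have "\<dots> = h y" using Suc.prems by (intro harmonic)
    finally show ?case .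
  qed simp
  have h_zero: "h y = 0" if "y \<notin> Z" for y
    using h_le[of y 0] that by (simp add: q_def)
  define c where "c = h x"
  \<comment> \<open>The complement of \<open>Z\<close> is not null for \<psi>, so it is occupied
    with positive probability at some time \<open>n\<close>, and then
    \<open>q n x < 1\<close>.\<close>
  have "c < 1"
  proof -
    have "emeasure \<psi> (space S - Z) \<noteq> 0"
      using \<psi>_nonzero \<psi>_Z Z_sub emeasure_subadditive[of "space S - Z" \<psi> Z]
      by (auto simp: sets_\<psi> Un_absorb2)
    then obtain n where n: "(T ^^ n) (indicator (space S - Z)) x \<noteq> 0"
      using irreducible[OF x, of "space S - Z"] by auto
    have "q n x + (T ^^ n) (indicator (space S - Z)) x
        = (T ^^ n) (\<lambda>y. indicator Z y + indicator (space S - Z) y) x"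
      unfolding q_def using x by (intro T_pow_add[symmetric]) auto
    also have "\<dots> = (T ^^ n) (\<lambda>_. 1) x"
      using x by (intro T_pow_cong) (auto simp: indicator_def)
    finally have "q n x + (T ^^ n) (indicator (space S - Z)) x = 1"
      using x by simp
    then have "q n x < 1"
      using n q_le_1[OF x, of n] by (cases "q n x = 1") (auto simp: ennreal_add_left_cancel)
    with h_le[of x n] show ?thesis by (simp add: c_def)
  qed
  define A where "A = {y\<in>space S. h y \<le> c}"
  have [measurable]: "A \<in> sets S" unfolding A_def by measurable
  have "space S - Z \<subseteq> A" by (auto simp: A_def h_zero)
  then have "space S = A \<union> Z" using Z_sub by (auto simp: A_def)
  then have \<psi>_A: "emeasure \<psi> A \<noteq> 0"
    using \<psi>_nonzero \<psi>_Z emeasure_subadditive[of A \<psi> Z] by (auto simp: sets_\<psi>)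
  have "x \<in> A" using x by (simp add: A_def c_def)
  \<comment> \<open>Optional stopping at the first visit to \<open>A\<close>, where \<open>h\<close> is at most \<open>c\<close>.\<close>
  have stop: "h y \<le> c + avoid S K A k y" if "y \<in> space S" for k y
    using that
  proof (induction k arbitrary: y)
    case 0
    then show ?case
      using h_le[of y 0] q_le_1[of y 0]
      by (cases "y \<in> A") (auto simp: A_def avoid_def intro: order_trans add_increasing)
  next
    case (Suc k)
    show ?case
    proof (cases "y \<in> A")
      case False
      have "h y = T h y" using Suc.prems by (simp add: harmonic)
      also have "\<dots> \<le> T (\<lambda>z. c + avoid S K A k z) y"
        using Suc by (intro T_mono) auto
      also have "\<dots> = c + T (avoid S K A k) y"
        using Suc.prems by (simp add: T_add)
      also have "T (avoid S K A k) y = avoid S K A (Suc k) y"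
        using False Suc.prems by (simp add: avoid_def)
      finally show ?thesis .
    qed (auto simp: A_def intro: add_increasing2)
  qed
  \<comment> \<open>The bound \<open>stop\<close> is applied after \<open>m\<close> steps. Outside
    \<open>Z\<close> the function \<open>h\<close> vanishes, so the constant \<open>c\<close> is
    needed on \<open>Z\<close> only; this produces the factor \<open>q m x\<close>.\<close>
  have "c \<le> c * q m x" for m
  proof -
    have "c \<le> c * q m x + (T ^^ m) (avoid S K A k) x" for k
    proof -
      have "c = (T ^^ m) h x" using x by (simp add: c_def harmonic_pow)
      also have "\<dots> \<le> (T ^^ m) (\<lambda>y. c * indicator Z y + avoid S K A k y) x"
      proof (rule T_pow_mono[OF x])
        fix y assume "y \<in> space S"
        then show "h y \<le> c * indicator Z y + avoid S K A k y"
          using stop[of y k] h_zero[of y] by (cases "y \<in> Z") auto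
      qed
      also have "\<dots> = c * q m x + (T ^^ m) (avoid S K A k) x"
        unfolding q_def using x by (simp add: T_pow_add T_pow_cmult)
      finally show ?thesis .
    qed
    moreover have "(\<lambda>k. c * q m x + (T ^^ m) (avoid S K A k) x) \<longlonglongrightarrow> c * q m x + 0"
      by (intro tendsto_add tendsto_const avoid_vanishes \<psi>_A \<open>x \<in> A\<close>) simp
    ultimately show ?thesis by (auto intro: LIMSEQ_le_const)
  qed
  moreover have "(\<lambda>m. c * q m x) \<longlonglongrightarrow> c * c"
    using q_tendsto[OF x] \<open>c < 1\<close> unfolding c_def[symmetric]
    by (intro ennreal_tendsto_cmult) (auto simp: less_trans[OF _ ennreal_one_less_top])
  ultimately have "c \<le> c * c" by (auto intro: LIMSEQ_le_const)
  have "c = 0"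
  proof (rule ccontr)
    assume "c \<noteq> 0"
    then have "c * c < 1 * c"
      using \<open>c < 1\<close> by (intro ennreal_mult_strict_right_mono)
        (auto simp: zero_less_iff_neq_zero less_trans[OF _ ennreal_one_less_top])
    with \<open>c \<le> c * c\<close> show False by simp
  qed
  then have "(\<lambda>n. q n x) \<longlonglongrightarrow> 0" using q_tendsto[OF x] by (simp add: c_def)
  moreover have "(T ^^ n) (indicator N) x \<le> q n x" for n
  proof -
    have "indicator N y \<le> (indicator Z y :: ennreal)" if "y \<in> space S" for y
      using that by (auto simp: Z_def indicator_def intro!: exI[of _ 0])
    then show ?thesis unfolding q_def using x by (intro T_pow_mono)
  qed
  ultimately show ?thesis
    by - (rule tendsto_sandwich[where f="\<lambda>_. 0" and h="\<lambda>n. q n x"], auto)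
qed

text \<open>Iterated subharmonicity gives \<open>u x \<le> (T ^^ n) u x\<close> for every
  \<open>n\<close>. Since \<open>u\<close> is at most \<open>m\<close> off a null set and at most
  \<open>B\<close> on it, the right side exceeds \<open>m\<close> by at most \<open>B\<close> times
  the probability of being in that null set at time \<open>n\<close>, which vanishes.\<close>

lemma limsup_avg_le_everywhere:
  assumes [measurable]: "g \<in> borel_measurable S"
    and bd: "\<And>y. y \<in> space S \<Longrightarrow> g y \<le> B" "B < \<top>" and x: "x \<in> space S"
  shows "limsup (\<lambda>n. avg n g x) \<le> (\<integral>\<^sup>+x. g x \<partial>\<nu>)"
proof -
  define m where "m = (\<integral>\<^sup>+x. g x \<partial>\<nu>)"
  define u where "u x = limsup (\<lambda>n. avg n g x)" for x
  have [measurable]: "u \<in> borel_measurable S" unfolding u_def by measurable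
  define N where "N = {y\<in>space S. \<not> u y \<le> m}"
  have [measurable]: "N \<in> sets S" unfolding N_def by measurable
  have "AE y in \<nu>. u y \<le> m"
    unfolding u_def m_def using bd by (intro AE_limsup_avg_le) auto
  then have N_null: "emeasure \<nu> N = 0"
    by (subst (asm) AE_iff_measurable[OF _ refl]) (auto simp: N_def)
  have u_le: "u y \<le> m + B * indicator N y" if "y \<in> space S" for y
    using limsup_avg_le[of y g B] that bd
    by (cases "y \<in> N") (auto simp: u_def N_def intro: add_increasing)
  have "u x \<le> (T ^^ n) u x" for n
    using x
  proof (induction n arbitrary: x)
    case (Suc n)
    have "u x \<le> T u x"
      unfolding u_def using bd Suc.prems by (intro limsup_avg_subharmonic) auto
    also have "\<dots> \<le> T ((T ^^ n) u) x" using Suc by (intro T_mono) auto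
    finally show ?case by simp
  qed simp
  also have "(T ^^ n) u x \<le> (T ^^ n) (\<lambda>y. m + B * indicator N y) x" for n
    by (intro T_pow_mono x u_le)
  also have "(T ^^ n) (\<lambda>y. m + B * indicator N y) x = m + B * (T ^^ n) (indicator N) x" for n
    using x by (simp add: T_pow_add T_pow_cmult)
  finally have "u x \<le> m + B * (T ^^ n) (indicator N) x" for n .
  moreover have "(\<lambda>n. m + B * (T ^^ n) (indicator N) x) \<longlonglongrightarrow> m + B * 0"
    using bd(2) N_null x
    by (intro tendsto_add tendsto_const ennreal_tendsto_cmult T_pow_null_vanishes) auto
  ultimately have "u x \<le> m" by (auto intro: LIMSEQ_le_const)
  then show ?thesis by (simp add: u_def m_def)
qed

theorem tendsto_avg_bounded:
  assumes [measurable]: "g \<in> borel_measurable S"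
    and bd: "\<And>y. y \<in> space S \<Longrightarrow> g y \<le> B" "B < \<top>" and x: "x \<in> space S"
  shows "(\<lambda>n. avg n g x) \<longlonglongrightarrow> (\<integral>\<^sup>+x. g x \<partial>\<nu>)"
proof (rule tendsto_avg_if_limsup_le[OF assms])
  show "limsup (\<lambda>n. avg n g x) \<le> (\<integral>\<^sup>+x. g x \<partial>\<nu>)"
    using bd x by (intro limsup_avg_le_everywhere) auto
  show "limsup (\<lambda>n. avg n (\<lambda>y. B - g y) x) \<le> (\<integral>\<^sup>+x. B - g x \<partial>\<nu>)"
    using bd x by (intro limsup_avg_le_everywhere[where B=B]) (auto simp: diff_le_self_ennreal)
qed

end

section \<open>The law of the chain\<close>

context Ionescu_Tulcea
begin

lemma nn_integral_lim_restrict: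
  assumes [measurable]: "F \<in> borel_measurable (PiM {0..<n} M)"
  shows "(\<integral>\<^sup>+\<omega>. F (restrict \<omega> {0..<n}) \<partial>PF.lim) = (\<integral>\<^sup>+\<omega>. F \<omega> \<partial>C 0 n (\<lambda>_. undefined))"
proof -
  have "(\<integral>\<^sup>+\<omega>. F (restrict \<omega> {0..<n}) \<partial>PF.lim)
      = (\<integral>\<^sup>+\<omega>. F \<omega> \<partial>distr PF.lim (PiM {0..<n} M) (\<lambda>\<omega>. restrict \<omega> {0..<n}))"
    by (intro nn_integral_distr[symmetric])
       (auto simp: measurable_cong_sets[OF PF.sets_lim refl] simp del: restrict_apply
         intro!: measurable_restrict_subset)
  also have "distr PF.lim (PiM {0..<n} M) (\<lambda>\<omega>. restrict \<omega> {0..<n}) = CI {0..<n}"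
    by (intro distr_lim) simp
  \<comment> \<open>\<open>CI\<close> is defined for arbitrary finite sets of coordinates through
    the least initial segment containing them, which here is the set itself.\<close>
  also have "up_to {0..<n} = n"
    using up_to_less[of "{0..<n}" "up_to {0..<n}"] up_to_iff[of "{0..<n}" n] by force
  then have "CI {0..<n} = C 0 n (\<lambda>_. undefined)"
    using distr_C[of n n "\<lambda>_. undefined" 0] by (simp add: CI_def)
  finally show ?thesis .
qed

text \<open>The one-step Markov property on path space: coordinate \<open>n\<close> is integrated
  out given the earlier ones. The restrictions make the dependence on the first \<open>n\<close>
  coordinates explicit.\<close>

lemma nn_integral_lim_Suc:
  assumes [measurable]: "\<phi> \<in> borel_measurable (PiM {0..<n} M)" "g \<in> borel_measurable (M n)"
  shows "(\<integral>\<^sup>+\<omega>. \<phi> (restrict \<omega> {0..<n}) * g (\<omega> n) \<partial>PF.lim) =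
    (\<integral>\<^sup>+\<omega>. \<phi> (restrict \<omega> {0..<n}) * (\<integral>\<^sup>+y. g y \<partial>P n (restrict \<omega> {0..<n})) \<partial>PF.lim)"
proof -
  let ?F = "\<lambda>\<omega>. \<phi> (restrict \<omega> {0..<n}) * g (\<omega> n)"
  have restr: "restrict (restrict \<omega> {0..<Suc n}) {0..<n} = restrict \<omega> {0..<n}" for \<omega> :: "nat \<Rightarrow> 'a"
    by (auto simp: fun_eq_iff)
  have F: "?F \<in> borel_measurable (PiM {0..<Suc n} M)"
    by (intro borel_measurable_times_ennreal measurable_compose[OF _ assms(1)]
        measurable_compose[OF _ assms(2)] measurable_restrict_subset measurable_component_singleton) auto
  have "(\<integral>\<^sup>+\<omega>. ?F \<omega> \<partial>PF.lim) = (\<integral>\<^sup>+\<omega>. ?F (restrict \<omega> {0..<Suc n}) \<partial>PF.lim)"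
    unfolding restr by simp
  also have "\<dots> = (\<integral>\<^sup>+\<omega>. ?F \<omega> \<partial>C 0 (Suc n) (\<lambda>_. undefined))"
    by (rule nn_integral_lim_restrict[OF F])
  also have "\<dots> = (\<integral>\<^sup>+\<omega>. \<integral>\<^sup>+\<omega>'. ?F \<omega>' \<partial>eP n \<omega> \<partial>C 0 n (\<lambda>_. undefined))"
    using measurable_eP[of n]
    by (simp, intro nn_integral_bind[where B="PiM {0..<Suc n} M"] F)
       (simp add: measurable_cong_sets[OF sets_C refl])
  also have "\<dots> = (\<integral>\<^sup>+\<omega>. \<phi> \<omega> * (\<integral>\<^sup>+y. g y \<partial>P n \<omega>) \<partial>C 0 n (\<lambda>_. undefined))"
  proof (rule nn_integral_cong)
    fix \<omega> assume "\<omega> \<in> space (C 0 n (\<lambda>_. undefined))"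
    then have \<omega>: "\<omega> \<in> space (PiM {0..<n} M)" by (simp add: space_C)
    then have "restrict (fun_upd \<omega> n y) {0..<n} = \<omega>" for y
      by (auto simp: space_PiM fun_eq_iff PiE_iff extensional_def restrict_def)
    with \<omega> F show "(\<integral>\<^sup>+\<omega>'. ?F \<omega>' \<partial>eP n \<omega>) = \<phi> \<omega> * (\<integral>\<^sup>+y. g y \<partial>P n \<omega>)"
      by (simp add: nn_integral_eP nn_integral_cmult measurable_cong_sets[OF sets_P refl])
  qed
  also have "\<dots> = (\<integral>\<^sup>+\<omega>. \<phi> (restrict \<omega> {0..<n}) * (\<integral>\<^sup>+y. g y \<partial>P n (restrict \<omega> {0..<n})) \<partial>PF.lim)"
    by (intro nn_integral_lim_restrict[symmetric] borel_measurable_times_ennreal assms(1)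
        measurable_compose[OF P nn_integral_measurable_subprob_algebra] assms(2))
  finally show ?thesis .
qed

end

section \<open>The chain started at a fixed state\<close>

locale chain_from = transition_kernel +
  fixes x assumes x: "x \<in> space S"
begin

abbreviation "chain_step \<equiv> (\<lambda>(n::nat) \<omega>. if n = 0 then return S x else K (\<omega> (n - 1)))"

sublocale IT: Ionescu_Tulcea chain_step "\<lambda>_. S"
proof (rule Ionescu_Tulcea.intro)
  show "chain_step n \<in> measurable (PiM {0..<n} (\<lambda>_. S)) (subprob_algebra S)" for n
    using x by (cases n) (auto intro!: measurable_compose[OF _ kernel_subprob] measurable_component_singleton
        simp: space_subprob_algebra prob_space_return prob_space_imp_subprob_space)
  show "prob_space (chain_step n \<omega>)" if "\<omega> \<in> space (PiM {0..<n} (\<lambda>_. S))" for n \<omega>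
    using x that by (cases n) (auto simp: prob_space_return space_PiM PiE_iff intro!: prob_space_K)
qed

abbreviation "law \<equiv> chain_law S K x"

lemma chain_law_eq: "law = IT.PF.lim"
  by (simp add: chain_law_def Let_def)

lemma sets_law [measurable_cong]: "sets law = sets (PiM UNIV (\<lambda>_. S))"
  by (simp add: chain_law_eq)

lemma space_law: "space law = space (PiM UNIV (\<lambda>_. S))"
  by (simp add: chain_law_eq)

lemma coordinate_measurable [measurable (raw)]: "(\<lambda>\<omega>. \<omega> n) \<in> measurable law S"
  by (subst measurable_cong_sets[OF sets_law refl]) (rule measurable_component_singleton, simp)

text \<open>The total mass stands as a factor, because \<open>law\<close> is shown to be a
  probability measure only further below.\<close>

lemma nn_integral_law_0:
  assumes [measurable]: "g \<in> borel_measurable S"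
  shows "(\<integral>\<^sup>+\<omega>. g (\<omega> 0) \<partial>law) = g x * emeasure law (space law)"
  using IT.nn_integral_lim_Suc[of "\<lambda>_. 1" 0 g] x
  by (simp add: chain_law_eq nn_integral_return)

lemma nn_integral_law_Suc:
  assumes [measurable]: "\<phi> \<in> borel_measurable (PiM {0..<Suc n} (\<lambda>_. S))" "g \<in> borel_measurable S"
  shows "(\<integral>\<^sup>+\<omega>. \<phi> (restrict \<omega> {0..<Suc n}) * g (\<omega> (Suc n)) \<partial>law) =
    (\<integral>\<^sup>+\<omega>. \<phi> (restrict \<omega> {0..<Suc n}) * T g (\<omega> n) \<partial>law)"
  unfolding chain_law_eq
  by (subst IT.nn_integral_lim_Suc) (auto simp: transfer_def)

sublocale law: prob_space law
proof
  show "emeasure law (space law) = 1"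
    using IT.nn_integral_lim_restrict[of "\<lambda>_. 1" 0] IT.prob_space_C[of "\<lambda>_. undefined" 0 0]
    by (simp add: chain_law_eq prob_space.emeasure_space_1 del: IT.C.simps)
qed

lemma nn_integral_coordinate:
  "g \<in> borel_measurable S \<Longrightarrow> (\<integral>\<^sup>+\<omega>. g (\<omega> n) \<partial>law) = (T ^^ n) g x"
proof (induction n arbitrary: g)
  case 0
  then show ?case by (simp add: nn_integral_law_0 law.emeasure_space_1)
next
  case (Suc n)
  then have "(\<integral>\<^sup>+\<omega>. g (\<omega> (Suc n)) \<partial>law) = (\<integral>\<^sup>+\<omega>. T g (\<omega> n) \<partial>law)"
    using nn_integral_law_Suc[of "\<lambda>_. 1" n g] by simp
  with Suc show ?case by (simp add: funpow_swap1 T_measurable)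
qed

lemma emeasure_coordinate:
  assumes [measurable]: "A \<in> sets S"
  shows "emeasure law {\<omega>\<in>space law. \<omega> n \<in> A} = (T ^^ n) (indicator A) x"
proof -
  have "emeasure law {\<omega>\<in>space law. \<omega> n \<in> A} = (\<integral>\<^sup>+\<omega>. indicator {\<omega>\<in>space law. \<omega> n \<in> A} \<omega> \<partial>law)"
    by (intro nn_integral_indicator[symmetric]) measurable
  also have "\<dots> = (\<integral>\<^sup>+\<omega>. indicator A (\<omega> n) \<partial>law)"
    by (intro nn_integral_cong) (auto simp: indicator_def)
  also have "\<dots> = (T ^^ n) (indicator A) x"
    by (intro nn_integral_coordinate) measurable
  finally show ?thesis .
qed

lemma emeasure_avoid:
  assumes [measurable]: "A \<in> sets S"
  shows "emeasure law {\<omega>\<in>space law. \<forall>j\<in>{m..m+k}. \<omega> j \<notin> A} = (T ^^ m) (avoid S K A k) x"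
proof -
  let ?I = "indicator (space S - A) :: _ \<Rightarrow> ennreal"
  let ?D = "\<lambda>h y. ?I y * T h y"
  have "(\<integral>\<^sup>+\<omega>. (\<Prod>j\<in>{m..m+k}. ?I (\<omega> j)) * g (\<omega> (m + k)) \<partial>law)
      = (T ^^ m) ((?D ^^ k) (\<lambda>y. ?I y * g y)) x"
    if "g \<in> borel_measurable S" for g
    using that
  \<comment> \<open>The factor \<open>g\<close> at the last time strengthens the claim for the
    induction: conditioning on all earlier coordinates moves one application of the killed operator
    into \<open>g\<close>.\<close>
  proof (induction k arbitrary: g)
    case 0
    then show ?case using nn_integral_coordinate[of "\<lambda>y. ?I y * g y" m] by simp
  next
    case (Suc k)
    note [measurable] = Suc.prems
    let ?\<phi> = "\<lambda>\<omega>. \<Prod>j\<in>{m..m+k}. ?I (\<omega> j)"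
    have \<phi>: "?\<phi> \<in> borel_measurable (PiM {0..<Suc (m + k)} (\<lambda>_. S))"
      by (intro borel_measurable_prod_ennreal measurable_compose[OF measurable_component_singleton]) auto
    have "(\<integral>\<^sup>+\<omega>. (\<Prod>j\<in>{m..m + Suc k}. ?I (\<omega> j)) * g (\<omega> (m + Suc k)) \<partial>law)
        = (\<integral>\<^sup>+\<omega>. ?\<phi> (restrict \<omega> {0..<Suc (m + k)}) * (?I (\<omega> (Suc (m + k))) * g (\<omega> (Suc (m + k)))) \<partial>law)"
      by (intro nn_integral_cong) (simp add: atLeastAtMostSuc_conv mult_ac)
    also have "\<dots> = (\<integral>\<^sup>+\<omega>. ?\<phi> (restrict \<omega> {0..<Suc (m + k)}) * T (\<lambda>y. ?I y * g y) (\<omega> (m + k)) \<partial>law)"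
      by (intro nn_integral_law_Suc[OF \<phi>]) measurable
    also have "\<dots> = (\<integral>\<^sup>+\<omega>. ?\<phi> \<omega> * T (\<lambda>y. ?I y * g y) (\<omega> (m + k)) \<partial>law)"
      by (intro nn_integral_cong) simp
    also have "\<dots> = (T ^^ m) ((?D ^^ k) (?D (\<lambda>y. ?I y * g y))) x"
      by (intro Suc.IH) measurable
    finally show ?case by (simp add: funpow_Suc_right del: funpow.simps)
  qed
  from this[of "\<lambda>_. 1"]
  have "(\<integral>\<^sup>+\<omega>. (\<Prod>j\<in>{m..m+k}. ?I (\<omega> j)) \<partial>law) = (T ^^ m) (avoid S K A k) x"
    by (simp add: avoid_def)
  moreover have "emeasure law {\<omega>\<in>space law. \<forall>j\<in>{m..m+k}. \<omega> j \<notin> A}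
      = (\<integral>\<^sup>+\<omega>. indicator {\<omega>\<in>space law. \<forall>j\<in>{m..m+k}. \<omega> j \<notin> A} \<omega> \<partial>law)"
    by (intro nn_integral_indicator[symmetric]) measurable
  moreover have "\<dots> = (\<integral>\<^sup>+\<omega>. (\<Prod>j\<in>{m..m+k}. ?I (\<omega> j)) \<partial>law)"
  proof (rule nn_integral_cong)
    fix \<omega> assume "\<omega> \<in> space law"
    then have "\<omega> j \<in> space S" for j by (auto simp: space_law space_PiM)
    then show "indicator {\<omega>\<in>space law. \<forall>j\<in>{m..m+k}. \<omega> j \<notin> A} \<omega> = (\<Prod>j\<in>{m..m+k}. ?I (\<omega> j))"
      using \<open>\<omega> \<in> space law\<close> by (auto simp: indicator_def prod_zero_iff intro!: prod.neutral[symmetric])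
  qed
  ultimately show ?thesis by simp
qed

text \<open>Infinitely many visits exclude staying away from \<open>A\<close> from time
  \<open>m\<close> on, so the decreasing events of no visit up to time \<open>m + k\<close> have a
  null intersection; continuity from above does the rest.\<close>

lemma T_pow_avoid_tendsto:
  assumes [measurable]: "A \<in> sets S" and io: "AE \<omega> in law. \<exists>\<^sub>\<infinity>n. \<omega> n \<in> A"
  shows "(\<lambda>k. (T ^^ m) (avoid S K A k) x) \<longlonglongrightarrow> 0"
proof -
  define E where "E k = {\<omega>\<in>space law. \<forall>j\<in>{m..m+k}. \<omega> j \<notin> A}" for k
  have [measurable]: "E k \<in> sets law" for k unfolding E_def by measurable
  have "AE \<omega> in law. \<omega> \<notin> (\<Inter>k. E k)"
    using io
  proof eventually_elim
    case (elim \<omega>)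
    then obtain n where "n \<ge> m" "\<omega> n \<in> A" by (auto simp: INFM_nat_le)
    then have "\<omega> \<notin> E (n - m)" by (auto simp: E_def)
    then show ?case by auto
  qed
  then have "emeasure law (\<Inter>k. E k) = 0"
    by (subst (asm) AE_iff_measurable[of "\<Inter>k. E k"]) (auto simp: E_def)
  moreover have "(\<lambda>k. emeasure law (E k)) \<longlonglongrightarrow> emeasure law (\<Inter>k. E k)"
    by (intro Lim_emeasure_decseq) (auto simp: decseq_def E_def)
  moreover have "emeasure law (E k) = (T ^^ m) (avoid S K A k) x" for k
    unfolding E_def by (rule emeasure_avoid) fact
  ultimately show ?thesis by simp
qed

end

text \<open>The invariant distribution is a parameter so that it can be the explicit joint density,
  whose integrals identify the limit.\<close>

lemma positive_harris_harris_kernel: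
  assumes "positive_harris S K" and \<nu>: "invariant_distribution S K \<nu>"
  obtains \<psi> where "harris_kernel S K \<nu> \<psi>"
proof -
  from assms(1) have "transition_kernel S K"
    by (simp add: positive_harris_def markov_kernel_def transition_kernel_def)
  then interpret transition_kernel S K .
  from assms(1) obtain \<psi> where irr: "irreducible_wrt S K \<psi>"
    and rec: "\<And>A x. A \<in> sets S \<Longrightarrow> emeasure \<psi> A > 0 \<Longrightarrow> x \<in> A \<Longrightarrow>
      AE \<omega> in chain_law S K x. \<exists>\<^sub>\<infinity>n. \<omega> n \<in> A"
    unfolding positive_harris_def harris_recurrent_def by blast
  have "harris_kernel S K \<nu> \<psi>"
  proof
    show "invariant_distribution S K \<nu>" by fact
    show "sets \<psi> = sets S" "emeasure \<psi> (space S) \<noteq> 0"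
      using irr by (auto simp: irreducible_wrt_def)
  next
    fix x A assume x: "x \<in> space S" and A[measurable]: "A \<in> sets S" and \<psi>: "emeasure \<psi> A \<noteq> 0"
    interpret chain_from S K x by standard fact
    show "\<exists>n. (T ^^ n) (indicator A) x \<noteq> 0"
    proof (rule ccontr)
      assume "\<not> ?thesis"
      then have "emeasure law {\<omega>\<in>space law. \<omega> n \<in> A} = 0" for n
        by (simp add: emeasure_coordinate)
      then have "AE \<omega> in law. \<omega> n \<notin> A" for n
        by (intro AE_I[of _ _ "{\<omega>\<in>space law. \<omega> n \<in> A}"]) auto
      then have "AE \<omega> in law. \<forall>n. \<omega> n \<notin> A" by (simp add: AE_all_countable)
      then have "AE \<omega> in law. \<not> (\<exists>n\<ge>1. \<omega> n \<in> A)" by eventually_elim auto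
      then have "emeasure law {\<omega>\<in>space law. \<exists>n\<ge>1. \<omega> n \<in> A} = 0"
        by (subst (asm) AE_iff_measurable[OF _ refl]) auto
      with irr x A \<psi> show False
        by (auto simp: irreducible_wrt_def zero_less_iff_neq_zero)
    qed
  next
    fix A x m assume A: "A \<in> sets S" and \<psi>: "emeasure \<psi> A \<noteq> 0" and xA: "x \<in> A"
    have "x \<in> space S" using A xA sets.sets_into_space by blast
    then interpret chain_from S K x by unfold_locales
    show "(\<lambda>k. (T ^^ m) (avoid S K A k) x) \<longlonglongrightarrow> 0"
      using rec[OF A _ xA] A \<psi> by (intro T_pow_avoid_tendsto) (auto simp: zero_less_iff_neq_zero)
  qed
  then show ?thesis by (rule that)
qed

section \<open>The stationary distribution of the multiple-proposal chain\<close>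

lemma measurable_pair_countable2:
  assumes "countable A" and f: "\<And>i. i \<in> A \<Longrightarrow> (\<lambda>x. f (x, i)) \<in> measurable M L"
  shows "f \<in> measurable (M \<Otimes>\<^sub>M count_space A) L"
  using measurable_compose[OF measurable_pair_swap'
    measurable_pair_measure_countable1[OF assms(1), of "\<lambda>(i, x). f (x, i)" M L]] f
  by (simp add: split_beta)

locale mp_algorithm =
  fixes \<Omega> :: "'a::euclidean_space set" and N :: nat
    and p :: "'a \<Rightarrow> real" and \<kappa> :: "'a \<Rightarrow> (nat \<Rightarrow> 'a) \<Rightarrow> real"
  assumes \<Omega>_borel: "\<Omega> \<in> sets borel"
    and p_density: "prob_density (leb_on \<Omega>) p"
    and \<kappa>_kernel: "proposal_kernel \<Omega> N \<kappa>"
    and markov: "markov_kernel (mp_states \<Omega> N) (mp_kernel \<Omega> N p \<kappa>)"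
begin

abbreviation "S \<equiv> mp_states \<Omega> N"
abbreviation "K \<equiv> mp_kernel \<Omega> N p \<kappa>"
abbreviation "L \<equiv> leb_on \<Omega>"
definition "idx = {1..N+1}"
definition "LN = leb_tuples \<Omega> N"
definition "LN1 = leb_tuples \<Omega> (N + 1)"
abbreviation "w \<equiv> mp_weight N p \<kappa>"

text \<open>This is \<open>N + 1\<close> times the joint density at \<open>(y, i)\<close>; the
  weights are its normalisation over \<open>i\<close>.\<close>

definition mass :: "nat \<Rightarrow> (nat \<Rightarrow> 'a) \<Rightarrow> real" where
  "mass i y = p (y i) * \<kappa> (y i) (omit N i y)"

definition start :: "'a \<Rightarrow> (nat \<Rightarrow> 'a) \<times> nat" where
  "start x = (\<lambda>j\<in>idx. x, 1)"

definition stationary :: "((nat \<Rightarrow> 'a) \<times> nat) measure" where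
  "stationary = density S (\<lambda>(y, i). ennreal (mass i y / real (N + 1)))"

definition weighted :: "('a \<Rightarrow> ennreal) \<Rightarrow> (nat \<Rightarrow> 'a) \<times> nat \<Rightarrow> ennreal" where
  "weighted \<phi> s = (\<Sum>j\<in>idx. ennreal (w (fst s) j) * \<phi> (fst s j))"

sublocale transition_kernel S K
  using markov by (simp add: markov_kernel_def transition_kernel_def)

lemma finite_idx [simp]: "finite idx" and card_idx: "card idx = N + 1"
  by (simp_all add: idx_def)

lemma insert_at_same: "i \<in> idx \<Longrightarrow> insert_at N i x z i = x"
  by (simp add: idx_def insert_at_def)

lemma LN1_eq: "LN1 = PiM idx (\<lambda>_. L)"
  by (simp add: LN1_def idx_def)

lemma S_eq: "S = LN1 \<Otimes>\<^sub>M count_space idx"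
  by (simp only: mp_states_def LN1_def idx_def)

lemma space_L [simp]: "space L = \<Omega>"
  using \<Omega>_borel by (simp add: space_restrict_space)

lemma sigma_finite_L: "sigma_finite_measure L"
  using \<Omega>_borel by (intro sigma_finite_measure_restrict_space sigma_finite_lborel) auto

sublocale prod: product_sigma_finite "\<lambda>_::nat. L"
  by (simp add: product_sigma_finite_def sigma_finite_L)

lemma sigma_finite_LN: "sigma_finite_measure LN"
  unfolding LN_def by (intro prod.sigma_finite) simp

lemma sigma_finite_LN1: "sigma_finite_measure LN1"
  unfolding LN1_def by (intro prod.sigma_finite) simp

lemma LN1_component: "y \<in> space LN1 \<Longrightarrow> i \<in> idx \<Longrightarrow> y i \<in> \<Omega>"
  by (auto simp: LN1_eq space_PiM PiE_iff)

lemma space_S: "space S = space LN1 \<times> idx"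
  by (simp add: S_eq space_pair_measure)

section \<open>Tuples with one entry inserted or omitted\<close>

lemma component_measurable [measurable (raw)]: "i \<in> idx \<Longrightarrow> (\<lambda>y. y i) \<in> measurable LN1 L"
  unfolding LN1_eq by (rule measurable_component_singleton)

lemma omit_measurable [measurable (raw)]:
  assumes "i \<in> idx" shows "omit N i \<in> measurable LN1 LN"
  unfolding omit_def[abs_def] LN_def
proof (rule measurable_restrict)
  fix j assume "j \<in> {1..N}"
  then show "(\<lambda>y. if j < i then y j else y (j + 1)) \<in> measurable LN1 L"
    by (cases "j < i") (auto intro!: component_measurable simp: idx_def)
qed

lemma insert_at_measurable [measurable (raw)]:
  assumes "i \<in> idx" shows "(\<lambda>(x, z). insert_at N i x z) \<in> measurable (L \<Otimes>\<^sub>M LN) LN1"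
  unfolding insert_at_def split_beta LN1_def
proof (rule measurable_restrict)
  fix j assume j: "j \<in> {1..N+1}"
  consider "j < i" | "j = i" | "i < j" by linarith
  then show "(\<lambda>q. if j < i then snd q j else if j = i then fst q else snd q (j - 1))
      \<in> measurable (L \<Otimes>\<^sub>M LN) L"
    using j assms
    by cases (auto intro!: measurable_compose[OF measurable_snd measurable_component_singleton]
        simp: LN_def idx_def)
qed

lemma insert_at_in_space:
  "i \<in> idx \<Longrightarrow> x \<in> \<Omega> \<Longrightarrow> z \<in> space LN \<Longrightarrow> insert_at N i x z \<in> space LN1"
  using measurable_space[OF insert_at_measurable, of i "(x, z)"] by (simp add: space_pair_measure)

lemma LN_extensional: "z \<in> space LN \<Longrightarrow> z \<in> extensional {1..N}"
  by (auto simp: LN_def space_PiM PiE_iff)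

lemma omit_insert_at: "i \<in> idx \<Longrightarrow> z \<in> space LN \<Longrightarrow> omit N i (insert_at N i x z) = z"
  using LN_extensional[of z]
  by (auto simp: idx_def omit_def insert_at_def fun_eq_iff extensional_def)

text \<open>A product measure is determined by its values on boxes, and the preimage of a box under
  insertion is the box with factor \<open>i\<close> moved to the front.\<close>

lemma distr_insert_at:
  assumes i: "i \<in> idx"
  shows "distr (L \<Otimes>\<^sub>M LN) LN1 (\<lambda>(x, z). insert_at N i x z) = LN1"
  unfolding LN1_eq
proof (rule prod.PiM_eqI)
  fix A assume A: "\<And>j. j \<in> idx \<Longrightarrow> A j \<in> sets L"
  \<comment> \<open>The increasing enumeration of the positions other than \<open>i\<close>: entry
    \<open>j\<close> of the shorter tuple becomes entry \<open>sh j\<close> of the longer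
    one.\<close>
  define sh where "sh j = (if j < i then j else j + 1)" for j
  have sh: "bij_betw sh {1..N} (idx - {i})"
  proof (rule bij_betw_byWitness[where f'="\<lambda>j. if j < i then j else j - 1"])
  qed (use i in \<open>auto simp: sh_def idx_def\<close>)
  have A_sub: "A j \<subseteq> \<Omega>" if "j \<in> idx" for j
    using sets.sets_into_space[OF A[OF that]] by simp
  have shA: "A (sh j) \<in> sets L" if "j \<in> {1..N}" for j
    using that sh by (intro A) (auto simp: bij_betw_def)
  have "(\<lambda>(x, z). insert_at N i x z) -` (Pi\<^sub>E idx A) \<inter> space (L \<Otimes>\<^sub>M LN)
      = A i \<times> Pi\<^sub>E {1..N} (\<lambda>j. A (sh j))" (is "?l = ?r")
  proof (intro set_eqI iffI)
    fix q assume q: "q \<in> ?l"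
    obtain x z where [simp]: "q = (x, z)" by (cases q)
    have mem: "insert_at N i x z j \<in> A j" if "j \<in> idx" for j using q that by auto
    have "z j \<in> A (sh j)" if "j \<in> {1..N}" for j
      using mem[of "sh j"] that i by (auto simp: sh_def insert_at_def idx_def split: if_splits)
    with q mem[OF i] i show "q \<in> ?r"
      by (auto simp: space_pair_measure insert_at_same space_PiM PiE_iff LN_def)
  next
    fix q assume q: "q \<in> ?r"
    obtain x z where [simp]: "q = (x, z)" by (cases q)
    from q have x: "x \<in> A i" and z: "\<And>j. j \<in> {1..N} \<Longrightarrow> z j \<in> A (sh j)"
      and ext: "z \<in> extensional {1..N}" by (auto simp: PiE_iff)
    have "sh j \<in> idx" if "j \<in> {1..N}" for j using that i by (auto simp: sh_def idx_def)
    then have z\<Omega>: "z j \<in> \<Omega>" if "j \<in> {1..N}" for j using z A_sub that by blast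
    have "insert_at N i x z j \<in> A j" if j: "j \<in> idx" for j
    proof -
      consider "j < i" | "j = i" | "i < j" by linarith
      then show ?thesis
      proof cases
        case 1
        then show ?thesis using z[of j] j i by (auto simp: insert_at_def sh_def idx_def)
      next
        case 2
        then show ?thesis using x i by (simp add: insert_at_same)
      next
        case 3
        then have "j - 1 \<in> {1..N}" "sh (j - 1) = j" using i j by (auto simp: sh_def idx_def)
        then show ?thesis using z[of "j - 1"] 3 j by (auto simp: insert_at_def idx_def)
      qed
    qed
    then have "insert_at N i x z \<in> Pi\<^sub>E idx A" by (auto simp: insert_at_def idx_def)
    with x A_sub[OF i] z\<Omega> ext show "q \<in> ?l"
      by (auto simp: space_pair_measure space_PiM PiE_iff LN_def)
  qed
  moreover have "Pi\<^sub>E idx A \<in> sets LN1"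
    unfolding LN1_eq using A by (intro sets_PiM_I_finite) auto
  ultimately have "emeasure (distr (L \<Otimes>\<^sub>M LN) (PiM idx (\<lambda>_. L)) (\<lambda>(x, z). insert_at N i x z)) (Pi\<^sub>E idx A)
      = emeasure (L \<Otimes>\<^sub>M LN) (A i \<times> Pi\<^sub>E {1..N} (\<lambda>j. A (sh j)))"
    using i by (simp add: emeasure_distr insert_at_measurable flip: LN1_eq)
  also have "\<dots> = emeasure L (A i) * emeasure LN (Pi\<^sub>E {1..N} (\<lambda>j. A (sh j)))"
    using A i shA unfolding LN_def
    by (intro sigma_finite_measure.emeasure_pair_measure_Times sigma_finite_LN[unfolded LN_def] sets_PiM_I_finite) auto
  also have "emeasure LN (Pi\<^sub>E {1..N} (\<lambda>j. A (sh j))) = (\<Prod>j\<in>{1..N}. emeasure L (A (sh j)))"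
    unfolding LN_def using shA by (intro prod.emeasure_PiM) auto
  also have "\<dots> = (\<Prod>j\<in>idx - {i}. emeasure L (A j))"
    by (rule prod.reindex_bij_betw[OF sh])
  also have "emeasure L (A i) * \<dots> = (\<Prod>j\<in>idx. emeasure L (A j))"
    using i by (intro prod.remove[symmetric]) auto
  finally show "emeasure (distr (L \<Otimes>\<^sub>M LN) (PiM idx (\<lambda>_. L)) (\<lambda>(x, z). insert_at N i x z)) (Pi\<^sub>E idx A)
      = (\<Prod>j\<in>idx. emeasure L (A j))" .
qed auto

lemma nn_integral_insert_at:
  assumes i: "i \<in> idx" and [measurable]: "\<phi> \<in> borel_measurable LN1"
  shows "(\<integral>\<^sup>+y. \<phi> y \<partial>LN1) = (\<integral>\<^sup>+x. \<integral>\<^sup>+z. \<phi> (insert_at N i x z) \<partial>LN \<partial>L)"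
proof -
  have m: "(\<lambda>q. \<phi> (case q of (x, z) \<Rightarrow> insert_at N i x z)) \<in> borel_measurable (L \<Otimes>\<^sub>M LN)"
    by (rule measurable_compose[OF insert_at_measurable[OF i]]) fact
  have "(\<integral>\<^sup>+y. \<phi> y \<partial>LN1) = (\<integral>\<^sup>+q. \<phi> (case q of (x, z) \<Rightarrow> insert_at N i x z) \<partial>(L \<Otimes>\<^sub>M LN))"
    by (subst distr_insert_at[OF i, symmetric]) (intro nn_integral_distr insert_at_measurable i, simp)
  also have "\<dots> = (\<integral>\<^sup>+x. \<integral>\<^sup>+z. \<phi> (insert_at N i x z) \<partial>LN \<partial>L)"
    using sigma_finite_measure.nn_integral_fst[OF sigma_finite_LN m] by simp
  finally show ?thesis .
qed

section \<open>Masses and weights\<close>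

lemma p_measurable [measurable]: "p \<in> borel_measurable L"
  and p_nonneg: "x \<in> \<Omega> \<Longrightarrow> 0 \<le> p x"
  and nn_integral_p: "(\<integral>\<^sup>+x. ennreal (p x) \<partial>L) = 1"
  using p_density by (auto simp: prob_density_def)

lemma \<kappa>_measurable: "(\<lambda>(x, z). \<kappa> x z) \<in> borel_measurable (L \<Otimes>\<^sub>M LN)"
  and \<kappa>_section_measurable [measurable (raw)]: "x \<in> \<Omega> \<Longrightarrow> \<kappa> x \<in> borel_measurable LN"
  and \<kappa>_nonneg: "x \<in> \<Omega> \<Longrightarrow> z \<in> space LN \<Longrightarrow> 0 \<le> \<kappa> x z"
  and nn_integral_\<kappa>: "x \<in> \<Omega> \<Longrightarrow> (\<integral>\<^sup>+z. ennreal (\<kappa> x z) \<partial>LN) = 1"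
  using \<kappa>_kernel by (auto simp: proposal_kernel_def prob_density_def LN_def)

lemma mass_measurable [measurable (raw)]:
  assumes "i \<in> idx" shows "mass i \<in> borel_measurable LN1"
proof -
  have "(\<lambda>y. (y i, omit N i y)) \<in> measurable LN1 (L \<Otimes>\<^sub>M LN)"
    by (intro measurable_Pair component_measurable omit_measurable assms)
  from measurable_compose[OF this \<kappa>_measurable]
  have "(\<lambda>y. \<kappa> (y i) (omit N i y)) \<in> borel_measurable LN1" by simp
  then show ?thesis
    unfolding mass_def[abs_def]
    by (intro borel_measurable_times measurable_compose[OF component_measurable p_measurable] assms)
qed

lemma mass_nonneg: "i \<in> idx \<Longrightarrow> y \<in> space LN1 \<Longrightarrow> 0 \<le> mass i y"
  unfolding mass_def
  by (intro mult_nonneg_nonneg p_nonneg \<kappa>_nonneg measurable_space[OF omit_measurable] LN1_component)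

lemma mp_weight_eq:
  "w y i = (if (\<Sum>j\<in>idx. mass j y) = 0 then 1 / real (N + 1) else mass i y / (\<Sum>j\<in>idx. mass j y))"
  unfolding mp_weight_def mass_def Let_def idx_def by (rule refl)

lemma weight_measurable [measurable (raw)]: "i \<in> idx \<Longrightarrow> (\<lambda>y. w y i) \<in> borel_measurable LN1"
  unfolding mp_weight_eq by measurable

lemma weight_nonneg: "i \<in> idx \<Longrightarrow> y \<in> space LN1 \<Longrightarrow> 0 \<le> w y i"
  unfolding mp_weight_eq by (auto intro!: divide_nonneg_nonneg sum_nonneg mass_nonneg)

lemma sum_weight: "(\<Sum>i\<in>idx. w y i) = 1"
  by (cases "(\<Sum>j\<in>idx. mass j y) = 0")
    (simp_all add: mp_weight_eq card_idx flip: sum_divide_distrib)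

lemma sum_ennreal_weight: "y \<in> space LN1 \<Longrightarrow> (\<Sum>i\<in>idx. ennreal (w y i)) = 1"
  using sum_weight[of y] by (subst sum_ennreal) (auto simp: weight_nonneg)

text \<open>In product form there is no exceptional set: the masses are nonnegative, so when their
  sum vanishes each of them does, and the default weight is multiplied by zero.\<close>

lemma total_mass_weight:
  assumes "y \<in> space LN1" "i \<in> idx"
  shows "(\<Sum>j\<in>idx. mass j y) * w y i = mass i y"
proof (cases "(\<Sum>j\<in>idx. mass j y) = 0")
  case True
  then have "mass i y = 0"
    using assms by (subst (asm) sum_nonneg_eq_0_iff) (auto intro: mass_nonneg)
  with True show ?thesis by simp
qed (simp add: mp_weight_eq)

section \<open>The two halves of one iteration\<close>

definition resampled :: "((nat \<Rightarrow> 'a) \<times> nat \<Rightarrow> ennreal) \<Rightarrow> (nat \<Rightarrow> 'a) \<Rightarrow> ennreal" where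
  "resampled g y = (\<Sum>j\<in>idx. ennreal (w y j) * g (y, j))"

text \<open>The expectation of \<open>g\<close> after one iteration that keeps \<open>x\<close> in
  position \<open>i\<close>, whereas \<open>resampled\<close> averages over the new index only. The
  halves are separated because they preserve the joint density for different reasons.\<close>

definition proposed :: "((nat \<Rightarrow> 'a) \<times> nat \<Rightarrow> ennreal) \<Rightarrow> nat \<Rightarrow> 'a \<Rightarrow> ennreal" where
  "proposed g i x = (\<integral>\<^sup>+z. ennreal (\<kappa> x z) * resampled g (insert_at N i x z) \<partial>LN)"

lemma section_measurable [measurable (raw)]:
  assumes "g \<in> borel_measurable S" "j \<in> idx"
  shows "(\<lambda>y. g (y, j)) \<in> borel_measurable LN1"
  using assms by (intro measurable_compose[OF _ assms(1)]) (auto simp: S_eq)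

lemma resampled_measurable [measurable (raw)]:
  "g \<in> borel_measurable S \<Longrightarrow> resampled g \<in> borel_measurable LN1"
  unfolding resampled_def[abs_def] by measurable

lemma proposed_integrand_measurable:
  assumes "i \<in> idx" and [measurable]: "h \<in> borel_measurable LN1"
  shows "(\<lambda>(x, z). ennreal (\<kappa> x z) * h (insert_at N i x z)) \<in> borel_measurable (L \<Otimes>\<^sub>M LN)"
  using \<kappa>_measurable measurable_compose[OF insert_at_measurable[OF assms(1)] assms(2)]
  by (simp add: split_beta)

lemma proposed_measurable [measurable (raw)]:
  assumes "g \<in> borel_measurable S" "i \<in> idx"
  shows "proposed g i \<in> borel_measurable L"
  using sigma_finite_measure.borel_measurable_nn_integral_fst[OF sigma_finite_LN
      proposed_integrand_measurable[OF assms(2) resampled_measurable[OF assms(1)]]]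
  by (simp add: proposed_def[abs_def])

text \<open>The right side involves the state only through its index and its current point; this is
  what later carries statements about almost every state over to starting points. The work lies in
  showing that the inner part \<open>Q\<close> is a measurable kernel, as the integral formula for
  \<open>bind\<close> requires.\<close>

lemma T_eq_proposed:
  assumes s: "(y, i) \<in> space S" and g[measurable]: "g \<in> borel_measurable S"
  shows "T g (y, i) = proposed g i (y i)"
proof -
  have y: "y \<in> space LN1" and i: "i \<in> idx" using s by (auto simp: space_S)
  have yi: "y i \<in> \<Omega>" by (rule LN1_component[OF y i])
  define Q where "Q z = (let y' = insert_at N i (y i) z
       in distr (point_measure idx (\<lambda>j. ennreal (w y' j))) S (\<lambda>j. (y', j)))" for z
  have ins[measurable]: "insert_at N i (y i) \<in> measurable LN LN1"
    using measurable_compose[OF measurable_Pair1'[of "y i" L LN] insert_at_measurable[OF i]] yi by simp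
  have nn_Q: "(\<integral>\<^sup>+s. h s \<partial>Q z) = resampled h (insert_at N i (y i) z)"
    if z: "z \<in> space LN" and [measurable]: "h \<in> borel_measurable S" for h z
  proof -
    have "insert_at N i (y i) z \<in> space LN1" by (rule insert_at_in_space[OF i yi z])
    then have "(\<lambda>j. (insert_at N i (y i) z, j)) \<in> measurable (point_measure idx (\<lambda>j. ennreal (w (insert_at N i (y i) z) j))) S"
      by (subst measurable_point_measure_eq1) (auto simp: space_S)
    then show ?thesis
      unfolding Q_def Let_def resampled_def
      by (subst nn_integral_distr) (auto simp: nn_integral_point_measure_finite mult.commute)
  qed
  \<comment> \<open>Measurability and total mass of \<open>Q\<close> are read off from the closed
    form \<open>nn_Q\<close> of its integrals, applied to indicators and to the constant
    \<open>1\<close>.\<close>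
  have "Q \<in> measurable LN (subprob_algebra S)"
  proof (rule measurable_subprob_algebra)
    have sp: "space S \<noteq> {}" using s by auto
    fix z assume z: "z \<in> space LN"
    show sets: "sets (Q z) = sets S" by (simp add: Q_def Let_def)
    have "emeasure (Q z) (space (Q z)) = (\<integral>\<^sup>+s. 1 \<partial>Q z)" by simp
    also have "\<dots> = 1"
      using z sum_ennreal_weight[OF insert_at_in_space[OF i yi z]]
      by (subst nn_Q) (auto simp: resampled_def)
    finally show "subprob_space (Q z)"
      using sp sets_eq_imp_space_eq[OF sets] by (intro subprob_spaceI) auto
  next
    fix A assume A[measurable]: "A \<in> sets S"
    have "emeasure (Q z) A = resampled (indicator A) (insert_at N i (y i) z)" if "z \<in> space LN" for z
    proof -
      have "emeasure (Q z) A = (\<integral>\<^sup>+s. indicator A s \<partial>Q z)"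
        by (intro nn_integral_indicator[symmetric]) (simp add: Q_def Let_def)
      with nn_Q[OF that, of "indicator A"] show ?thesis by simp
    qed
    then show "(\<lambda>z. emeasure (Q z) A) \<in> borel_measurable LN"
      by (subst measurable_cong) (auto intro!: measurable_compose[OF ins] resampled_measurable)
  qed
  then have "T g (y, i) = (\<integral>\<^sup>+z. \<integral>\<^sup>+s. g s \<partial>Q z \<partial>density LN (\<lambda>z. ennreal (\<kappa> (y i) z)))"
    unfolding transfer_def mp_kernel_def prod.case LN_def[symmetric] idx_def[symmetric] Q_def[symmetric]
    by (intro nn_integral_bind[where B=S] g) (simp add: measurable_cong_sets[OF sets_density refl])
  also have "\<dots> = (\<integral>\<^sup>+z. resampled g (insert_at N i (y i) z) \<partial>density LN (\<lambda>z. ennreal (\<kappa> (y i) z)))"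
    by (intro nn_integral_cong nn_Q g) simp
  also have "\<dots> = proposed g i (y i)"
    unfolding proposed_def using yi
    by (intro nn_integral_density) (auto intro!: measurable_compose[OF ins] resampled_measurable
      measurable_compose[OF \<kappa>_section_measurable measurable_ennreal])
  finally show ?thesis .
qed

text \<open>Inserting \<open>x\<close> at position \<open>i\<close> turns \<open>mass i\<close> into
  \<open>p x * \<kappa> x z\<close>, since omitting the inserted entry returns
  \<open>z\<close>.\<close>

lemma nn_integral_mass:
  assumes i: "i \<in> idx" and [measurable]: "h \<in> borel_measurable LN1"
  shows "(\<integral>\<^sup>+y. ennreal (mass i y) * h y \<partial>LN1)
      = (\<integral>\<^sup>+x. ennreal (p x) * (\<integral>\<^sup>+z. ennreal (\<kappa> x z) * h (insert_at N i x z) \<partial>LN) \<partial>L)"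
proof -
  have "(\<integral>\<^sup>+y. ennreal (mass i y) * h y \<partial>LN1)
      = (\<integral>\<^sup>+x. \<integral>\<^sup>+z. ennreal (mass i (insert_at N i x z)) * h (insert_at N i x z) \<partial>LN \<partial>L)"
    using i by (intro nn_integral_insert_at) measurable
  also have "\<dots> = (\<integral>\<^sup>+x. \<integral>\<^sup>+z. ennreal (p x) * (ennreal (\<kappa> x z) * h (insert_at N i x z)) \<partial>LN \<partial>L)"
  proof (intro nn_integral_cong)
    fix x z assume "x \<in> space L" "z \<in> space LN"
    then show "ennreal (mass i (insert_at N i x z)) * h (insert_at N i x z)
        = ennreal (p x) * (ennreal (\<kappa> x z) * h (insert_at N i x z))"
      using i by (simp add: mass_def insert_at_same omit_insert_at ennreal_mult
          p_nonneg \<kappa>_nonneg mult.assoc)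
  qed
  also have "\<dots> = (\<integral>\<^sup>+x. ennreal (p x) * (\<integral>\<^sup>+z. ennreal (\<kappa> x z) * h (insert_at N i x z) \<partial>LN) \<partial>L)"
    using measurable_Pair2[OF proposed_integrand_measurable[OF assms]]
    by (intro nn_integral_cong nn_integral_cmult) simp
  finally show ?thesis .
qed

text \<open>Entry \<open>i\<close> has density \<open>p\<close> under \<open>mass i\<close>, because
  each \<open>\<kappa> x\<close> integrates to one.\<close>

lemma nn_integral_mass_component:
  assumes i: "i \<in> idx" and h: "h \<in> borel_measurable L"
  shows "(\<integral>\<^sup>+y. ennreal (mass i y) * h (y i) \<partial>LN1) = (\<integral>\<^sup>+x. ennreal (p x) * h x \<partial>L)"
proof -
  have "(\<integral>\<^sup>+y. ennreal (mass i y) * h (y i) \<partial>LN1)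
      = (\<integral>\<^sup>+x. ennreal (p x) * (\<integral>\<^sup>+z. ennreal (\<kappa> x z) * h (insert_at N i x z i) \<partial>LN) \<partial>L)"
    using i h by (intro nn_integral_mass measurable_compose[OF component_measurable])
  also have "\<dots> = (\<integral>\<^sup>+x. ennreal (p x) * h x \<partial>L)"
    using i by (intro nn_integral_cong)
      (simp add: insert_at_same nn_integral_multc nn_integral_\<kappa>
        measurable_compose[OF \<kappa>_section_measurable measurable_ennreal])
  finally show ?thesis .
qed

section \<open>Invariance of the joint density\<close>

lemma nn_integral_stationary:
  assumes g[measurable]: "g \<in> borel_measurable S"
  shows "(\<integral>\<^sup>+s. g s \<partial>stationary)
      = (\<Sum>i\<in>idx. \<integral>\<^sup>+y. ennreal (mass i y) * g (y, i) \<partial>LN1) / of_nat (N + 1)"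
proof -
  have [measurable]: "(\<lambda>(y, i). ennreal (mass i y / real (N + 1))) \<in> borel_measurable S"
    unfolding S_eq by (rule measurable_pair_countable2) auto
  then have m: "(\<lambda>s. (case s of (y, i) \<Rightarrow> ennreal (mass i y / real (N + 1))) * g s) \<in> borel_measurable S"
    using g by (rule borel_measurable_times_ennreal)
  interpret pair_sigma_finite LN1 "count_space idx"
    by (intro pair_sigma_finite.intro sigma_finite_LN1 sigma_finite_measure_count_space_finite) simp
  have "(\<integral>\<^sup>+s. g s \<partial>stationary) = (\<integral>\<^sup>+s. (case s of (y, i) \<Rightarrow> ennreal (mass i y / real (N + 1))) * g s \<partial>S)"
    unfolding stationary_def by (intro nn_integral_density) measurable
  also have "\<dots> = (\<integral>\<^sup>+i. \<integral>\<^sup>+y. ennreal (mass i y / real (N + 1)) * g (y, i) \<partial>LN1 \<partial>count_space idx)"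
    using nn_integral_snd[unfolded S_eq[symmetric], OF m, symmetric] by (simp only: prod.case)
  also have "\<dots> = (\<Sum>i\<in>idx. \<integral>\<^sup>+y. ennreal (mass i y / real (N + 1)) * g (y, i) \<partial>LN1)"
    by (intro nn_integral_count_space_finite) simp
  also have "\<dots> = (\<Sum>i\<in>idx. (\<integral>\<^sup>+y. ennreal (mass i y) * g (y, i) \<partial>LN1) / of_nat (N + 1))"
  proof (intro sum.cong refl)
    fix i assume i: "i \<in> idx"
    have "(\<integral>\<^sup>+y. ennreal (mass i y / real (N + 1)) * g (y, i) \<partial>LN1)
        = (\<integral>\<^sup>+y. ennreal (mass i y) * g (y, i) / of_nat (N + 1) \<partial>LN1)"
    proof (rule nn_integral_cong)
      fix y assume "y \<in> space LN1"
      then have "ennreal (mass i y / real (N + 1)) = ennreal (mass i y) / of_nat (N + 1)"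
        unfolding ennreal_of_nat_eq_real_of_nat
        using i mass_nonneg by (intro divide_ennreal[symmetric]) auto
      then show "ennreal (mass i y / real (N + 1)) * g (y, i) = ennreal (mass i y) * g (y, i) / of_nat (N + 1)"
        by (simp add: divide_ennreal_def mult_ac)
    qed
    also have "\<dots> = (\<integral>\<^sup>+y. ennreal (mass i y) * g (y, i) \<partial>LN1) / of_nat (N + 1)"
      using i by (intro nn_integral_divide) measurable
    finally show "(\<integral>\<^sup>+y. ennreal (mass i y / real (N + 1)) * g (y, i) \<partial>LN1)
        = (\<integral>\<^sup>+y. ennreal (mass i y) * g (y, i) \<partial>LN1) / of_nat (N + 1)" .
  qed
  finally show ?thesis by (simp add: divide_ennreal_def sum_distrib_right)
qed

text \<open>Redrawing the index from its conditional distribution given the tuple leaves the joint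
  density unchanged: total mass times the weight of \<open>j\<close> is the mass of
  \<open>j\<close>.\<close>

lemma sum_nn_integral_mass_resampled:
  assumes [measurable]: "g \<in> borel_measurable S"
  shows "(\<Sum>i\<in>idx. \<integral>\<^sup>+y. ennreal (mass i y) * resampled g y \<partial>LN1)
      = (\<Sum>j\<in>idx. \<integral>\<^sup>+y. ennreal (mass j y) * g (y, j) \<partial>LN1)"
proof -
  have "(\<Sum>i\<in>idx. \<integral>\<^sup>+y. ennreal (mass i y) * resampled g y \<partial>LN1)
      = (\<integral>\<^sup>+y. (\<Sum>i\<in>idx. ennreal (mass i y) * resampled g y) \<partial>LN1)"
    by (intro nn_integral_sum[symmetric]) measurable
  also have "\<dots> = (\<integral>\<^sup>+y. (\<Sum>j\<in>idx. ennreal (mass j y) * g (y, j)) \<partial>LN1)"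
  proof (rule nn_integral_cong)
    fix y assume y: "y \<in> space LN1"
    define D where "D = (\<Sum>j\<in>idx. mass j y)"
    have D: "0 \<le> D" unfolding D_def using y by (intro sum_nonneg mass_nonneg) auto
    have "(\<Sum>i\<in>idx. ennreal (mass i y) * resampled g y) = ennreal D * resampled g y"
      unfolding D_def using y
      by (subst sum_ennreal[symmetric]) (auto intro: mass_nonneg simp: sum_distrib_right)
    also have "\<dots> = (\<Sum>j\<in>idx. ennreal (D * w y j) * g (y, j))"
      unfolding resampled_def using y D
      by (simp add: sum_distrib_left ennreal_mult weight_nonneg mult.assoc)
    also have "\<dots> = (\<Sum>j\<in>idx. ennreal (mass j y) * g (y, j))"
      unfolding D_def using total_mass_weight[OF y] by (intro sum.cong) auto
    finally show "(\<Sum>i\<in>idx. ennreal (mass i y) * resampled g y)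
        = (\<Sum>j\<in>idx. ennreal (mass j y) * g (y, j))" .
  qed
  also have "\<dots> = (\<Sum>j\<in>idx. \<integral>\<^sup>+y. ennreal (mass j y) * g (y, j) \<partial>LN1)"
    by (intro nn_integral_sum) measurable
  finally show ?thesis .
qed

text \<open>Refreshing the other entries is Gibbs resampling given the current point and index, and
  redrawing the index is Gibbs resampling given the tuple; each half preserves the joint
  density.\<close>

lemma nn_integral_stationary_T:
  assumes g[measurable]: "g \<in> borel_measurable S"
  shows "(\<integral>\<^sup>+s. T g s \<partial>stationary) = (\<integral>\<^sup>+s. g s \<partial>stationary)"
proof -
  have "(\<integral>\<^sup>+y. ennreal (mass i y) * T g (y, i) \<partial>LN1)
      = (\<integral>\<^sup>+y. ennreal (mass i y) * resampled g y \<partial>LN1)" if i: "i \<in> idx" for i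
  proof -
    have "(\<integral>\<^sup>+y. ennreal (mass i y) * T g (y, i) \<partial>LN1)
        = (\<integral>\<^sup>+y. ennreal (mass i y) * proposed g i (y i) \<partial>LN1)"
      using i by (intro nn_integral_cong) (simp add: T_eq_proposed space_S g)
    also have "\<dots> = (\<integral>\<^sup>+x. ennreal (p x) * proposed g i x \<partial>L)"
      using i by (intro nn_integral_mass_component) measurable
    also have "\<dots> = (\<integral>\<^sup>+y. ennreal (mass i y) * resampled g y \<partial>LN1)"
      unfolding proposed_def using i by (intro nn_integral_mass[symmetric]) measurable
    finally show ?thesis .
  qed
  then show ?thesis
    using sum_nn_integral_mass_resampled[OF g]
    by (simp add: nn_integral_stationary)
qed

lemma invariant_stationary: "invariant_distribution S K stationary"
  unfolding invariant_distribution_def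
proof (intro conjI)
  have sets[measurable_cong, simp]: "sets stationary = sets S" by (simp add: stationary_def)
  have [simp]: "space stationary = space S" by (simp add: stationary_def)
  show "sets stationary = sets S" by simp
  have "emeasure stationary (space stationary) = (\<integral>\<^sup>+s. 1 \<partial>stationary)" by simp
  also have "\<dots> = (\<Sum>i\<in>idx. \<integral>\<^sup>+y. ennreal (mass i y) * 1 \<partial>LN1) / of_nat (N + 1)"
    by (intro nn_integral_stationary) measurable
  also have "(\<Sum>i\<in>idx. \<integral>\<^sup>+y. ennreal (mass i y) * 1 \<partial>LN1) = (\<Sum>i\<in>idx. 1)"
    using nn_integral_mass_component[of _ "\<lambda>_. 1"]
    by (intro sum.cong) (auto simp: nn_integral_p)
  also have "\<dots> / of_nat (N + 1) = (1::ennreal)"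
    by (simp only: sum_constant card_idx mult_1_right)
      (intro ennreal_divide_self, auto simp: of_nat_less_top simp del: of_nat_Suc of_nat_add)
  finally show prob: "prob_space stationary" by (rule prob_spaceI)
  then have ne: "space stationary \<noteq> {}" by (rule prob_space.not_empty)
  have K: "K \<in> measurable stationary (subprob_algebra S)"
    using kernel_subprob by (simp add: measurable_cong_sets[OF sets refl])
  show "stationary \<bind> K = stationary"
  proof (rule measure_eqI)
    show "sets (stationary \<bind> K) = sets stationary"
      using sets_bind[OF sets_kernel[OF K] ne] by simp
    fix A assume "A \<in> sets (stationary \<bind> K)"
    then have A[measurable]: "A \<in> sets S" using sets_bind[OF sets_kernel[OF K] ne] by simp
    have "emeasure (stationary \<bind> K) A = (\<integral>\<^sup>+s. emeasure (K s) A \<partial>stationary)"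
      by (rule emeasure_bind[OF ne K A])
    also have "\<dots> = (\<integral>\<^sup>+s. T (indicator A) s \<partial>stationary)"
      unfolding transfer_def by (intro nn_integral_cong) (simp add: sets_K)
    also have "\<dots> = emeasure stationary A"
      by (simp add: nn_integral_stationary_T)
    finally show "emeasure (stationary \<bind> K) A = emeasure stationary A" .
  qed
qed

lemma weighted_measurable [measurable (raw)]:
  assumes "\<phi> \<in> borel_measurable L" shows "weighted \<phi> \<in> borel_measurable S"
  unfolding weighted_def[abs_def] S_eq
  by (intro borel_measurable_sum borel_measurable_times_ennreal
      measurable_compose[OF measurable_compose[OF measurable_fst weight_measurable] measurable_ennreal]
      measurable_compose[OF measurable_compose[OF measurable_fst component_measurable] assms])

text \<open>The weighted sum is the conditional expectation, given the tuple, of \<phi> at the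
  selected entry. So both have the same integral, and the selected entry is distributed according to
  the target.\<close>

lemma nn_integral_stationary_weighted:
  assumes [measurable]: "\<phi> \<in> borel_measurable L"
  shows "(\<integral>\<^sup>+s. weighted \<phi> s \<partial>stationary) = (\<integral>\<^sup>+x. \<phi> x \<partial>target \<Omega> p)"
proof -
  let ?g = "\<lambda>s. \<phi> (fst s (snd s))"
  have g: "?g \<in> borel_measurable S"
  proof -
    have "(\<lambda>s. \<phi> (fst s (snd s))) \<in> borel_measurable (LN1 \<Otimes>\<^sub>M count_space idx)"
      by (rule measurable_pair_countable2)
        (auto intro!: measurable_compose[OF component_measurable])
    then show ?thesis by (simp add: S_eq)
  qed
  have "weighted \<phi> (y, i) = resampled ?g y" for y i
    by (simp add: weighted_def resampled_def)
  then have "(\<integral>\<^sup>+s. weighted \<phi> s \<partial>stationary)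
      = (\<Sum>i\<in>idx. \<integral>\<^sup>+y. ennreal (mass i y) * resampled ?g y \<partial>LN1) / of_nat (N + 1)"
    by (subst nn_integral_stationary) (auto simp: weighted_measurable)
  also have "\<dots> = (\<Sum>j\<in>idx. \<integral>\<^sup>+y. ennreal (mass j y) * \<phi> (y j) \<partial>LN1) / of_nat (N + 1)"
    by (subst sum_nn_integral_mass_resampled[OF g]) simp
  also have "\<dots> = (\<Sum>j\<in>idx. \<integral>\<^sup>+x. ennreal (p x) * \<phi> x \<partial>L) / of_nat (N + 1)"
    by (intro arg_cong2[where f="(/)"] sum.cong nn_integral_mass_component) auto
  also have "\<dots> = (\<integral>\<^sup>+x. ennreal (p x) * \<phi> x \<partial>L) * of_nat (N + 1) / of_nat (N + 1)"
    by (simp only: sum_constant card_idx) (simp add: mult.commute)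
  also have "\<dots> = (\<integral>\<^sup>+x. ennreal (p x) * \<phi> x \<partial>L)"
    by (intro mult_divide_eq_ennreal) (auto simp: ennreal_of_nat_neq_top simp del: of_nat_Suc of_nat_add)
  also have "\<dots> = (\<integral>\<^sup>+x. \<phi> x \<partial>target \<Omega> p)"
    unfolding target_def by (intro nn_integral_density[symmetric]) measurable
  finally show ?thesis .
qed

end

section \<open>Estimators along the chain\<close>

lemma tendsto_enn2real_finite:
  assumes "(u \<longlongrightarrow> l) F" "l < \<top>" shows "((\<lambda>n. enn2real (u n)) \<longlongrightarrow> enn2real l) F"
  using assms by (intro tendsto_enn2real) auto

lemma enn2real_sum_finite:
  "(\<And>i. i \<in> I \<Longrightarrow> f i < \<top>) \<Longrightarrow> enn2real (\<Sum>i\<in>I. f i) = (\<Sum>i\<in>I. enn2real (f i))"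
proof (induction I rule: infinite_finite_induct)
  case (insert i I)
  then show ?case by (simp add: enn2real_plus ennreal_sum_less_top)
qed auto

lemma enn2real_divide_of_nat: "enn2real (a / of_nat n) = enn2real a / real n"
proof (cases "n = 0")
  case False
  then have "inverse (of_nat n) = ennreal (1 / real n)"
    by (simp add: ennreal_of_nat_eq_real_of_nat inverse_ennreal divide_inverse)
  then show ?thesis
    by (simp add: divide_ennreal_def enn2real_mult)
qed simp

lemma inner_signed_Basis_le_norm:
  "b \<in> Basis \<union> uminus ` Basis \<Longrightarrow> x \<bullet> b \<le> norm x"
  using norm_cauchy_schwarz[of x b] by auto

context mp_algorithm
begin

section \<open>From states with index one to starting points\<close>

lemma start_measurable [measurable]: "start \<in> measurable L S"
proof -
  have "(\<lambda>x. \<lambda>j\<in>idx. x) \<in> measurable L LN1"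
    unfolding LN1_eq by (intro measurable_restrict) simp
  then show ?thesis
    unfolding start_def[abs_def] S_eq
    by (intro measurable_Pair measurable_const) (auto simp: idx_def)
qed

lemma start_in_space: "x \<in> \<Omega> \<Longrightarrow> start x \<in> space S"
  using measurable_space[OF start_measurable] by simp

lemma mp_run_eq: "mp_run \<Omega> N p \<kappa> x = chain_law S K (start x)"
  unfolding mp_run_def start_def idx_def by (rule refl)

lemma one_in_idx: "1 \<in> idx"
  by (simp add: idx_def)

lemma T_start:
  assumes "y \<in> space LN1" "g \<in> borel_measurable S"
  shows "T g (start (y 1)) = T g (y, 1)"
proof -
  have y1: "y 1 \<in> \<Omega>" by (rule LN1_component[OF assms(1) one_in_idx])
  have "T g (start (y 1)) = proposed g 1 (y 1)"
    using start_in_space[OF y1] one_in_idx assms(2) unfolding start_def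
    by (subst T_eq_proposed) auto
  with assms one_in_idx show ?thesis by (simp add: T_eq_proposed space_S)
qed

text \<open>On states with index \<open>1\<close>, the entry \<open>y 1\<close> follows the target
  up to the factor \<open>1 / (N + 1)\<close>. An exceptional set which there depends on
  \<open>y 1\<close> alone is therefore null for the target.\<close>

lemma AE_target_start:
  assumes [measurable]: "Measurable.pred S P" and ae: "AE s in stationary. P s"
    and dep: "\<And>y. y \<in> space LN1 \<Longrightarrow> P (start (y 1)) = P (y, 1)"
  shows "AE x in target \<Omega> p. P (start x)"
proof -
  define g where "g = (indicator {s\<in>space S. \<not> P s} :: _ \<Rightarrow> ennreal)"
  have g[measurable]: "g \<in> borel_measurable S" unfolding g_def by measurable
  have "AE s in stationary. g s = 0"
    using ae by eventually_elim (auto simp: g_def)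
  then have "(\<integral>\<^sup>+s. g s \<partial>stationary) = 0"
    by (subst nn_integral_0_iff_AE) (auto simp: stationary_def)
  \<comment> \<open>The integral is a sum of nonnegative terms over the index; as it vanishes, so
    does the term for index \<open>1\<close>.\<close>
  then have "(\<integral>\<^sup>+y. ennreal (mass 1 y) * g (y, 1) \<partial>LN1) = 0"
    using one_in_idx by (simp add: nn_integral_stationary[OF g] flip: of_nat_Suc)
  also have "(\<integral>\<^sup>+y. ennreal (mass 1 y) * g (y, 1) \<partial>LN1)
      = (\<integral>\<^sup>+y. ennreal (mass 1 y) * g (start (y 1)) \<partial>LN1)"
    using dep one_in_idx start_in_space LN1_component
    by (intro nn_integral_cong) (auto simp: g_def space_S indicator_def)
  also have "\<dots> = (\<integral>\<^sup>+x. ennreal (p x) * g (start x) \<partial>L)"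
    by (intro nn_integral_mass_component[OF one_in_idx] measurable_compose[OF start_measurable g])
  finally have "AE x in L. ennreal (p x) * g (start x) = 0"
    by (subst (asm) nn_integral_0_iff_AE)
      (auto intro!: borel_measurable_times_ennreal measurable_compose[OF start_measurable g])
  then show ?thesis
    unfolding target_def
  proof (subst AE_density)
    assume "AE x in L. ennreal (p x) * g (start x) = 0"
    then show "AE x in L. 0 < ennreal (p x) \<longrightarrow> P (start x)"
      using AE_space
      by eventually_elim (auto simp: g_def start_in_space indicator_def split: if_splits)
  qed measurable
qed

section \<open>Expectations of the estimators\<close>

definition average :: "('a \<Rightarrow> 'b::real_vector) \<Rightarrow> (nat \<Rightarrow> 'a) \<times> nat \<Rightarrow> 'b" where
  "average h s = (\<Sum>i\<in>idx. w (fst s) i *\<^sub>R h (fst s i))"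

lemma is_estimator_eq:
  "is_estimator N p \<kappa> h n \<omega> = (1 / real n) *\<^sub>R (\<Sum>l = 1..n. average h (\<omega> l))"
  unfolding is_estimator_def average_def idx_def by (rule refl)

lemma average_measurable [measurable (raw)]:
  fixes h :: "'a \<Rightarrow> 'b::euclidean_space"
  assumes "h \<in> borel_measurable L" shows "average h \<in> borel_measurable S"
  unfolding average_def[abs_def] S_eq
  by (intro borel_measurable_sum borel_measurable_scaleR
      measurable_compose[OF measurable_fst weight_measurable]
      measurable_compose[OF measurable_compose[OF measurable_fst component_measurable] assms])

lemma weighted_ennreal:
  assumes "s \<in> space S" "\<And>x. x \<in> \<Omega> \<Longrightarrow> 0 \<le> h x"
  shows "weighted (\<lambda>x. ennreal (h x)) s = ennreal (average h s)"
proof -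
  have "weighted (\<lambda>x. ennreal (h x)) s = (\<Sum>i\<in>idx. ennreal (w (fst s) i * h (fst s i)))"
    unfolding weighted_def using assms
    by (intro sum.cong refl) (auto simp: space_S ennreal_mult weight_nonneg LN1_component)
  also have "\<dots> = ennreal (average h s)"
    unfolding average_def real_scaleR_def using assms
    by (intro sum_ennreal) (auto simp: space_S intro!: mult_nonneg_nonneg weight_nonneg assms(2) LN1_component)
  finally show ?thesis .
qed

lemma weighted_mono:
  "s \<in> space S \<Longrightarrow> (\<And>x. x \<in> \<Omega> \<Longrightarrow> \<phi> x \<le> \<phi>' x) \<Longrightarrow> weighted \<phi> s \<le> weighted \<phi>' s"
  unfolding weighted_def by (intro sum_mono mult_left_mono) (auto simp: space_S LN1_component)

lemma weighted_le:
  assumes "s \<in> space S" "\<And>x. x \<in> \<Omega> \<Longrightarrow> \<phi> x \<le> c" shows "weighted \<phi> s \<le> c"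
proof -
  have "weighted \<phi> s \<le> weighted (\<lambda>_. c) s" by (intro weighted_mono assms)
  also have "\<dots> = c"
    using assms(1) sum_ennreal_weight[of "fst s"]
    by (auto simp: weighted_def space_S simp flip: sum_distrib_right)
  finally show ?thesis .
qed

lemma norm_average_le:
  assumes s: "s \<in> space S"
  shows "ennreal (norm (average h s)) \<le> weighted (\<lambda>x. ennreal (norm (h x))) s"
proof -
  have "norm (average h s) \<le> (\<Sum>i\<in>idx. norm (w (fst s) i *\<^sub>R h (fst s i)))"
    unfolding average_def by (rule norm_sum)
  also have "\<dots> = average (\<lambda>x. norm (h x)) s"
    unfolding average_def using s by (intro sum.cong) (auto simp: space_S weight_nonneg)
  finally show ?thesis using s by (subst weighted_ennreal) (auto intro: ennreal_leI)
qed

text \<open>Since \<open>ennreal\<close> sends negative reals to \<open>0\<close>, the vectors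
  \<open>b\<close> and \<open>- b\<close> yield the positive and the negative part of a coordinate,
  and the claim reduces to averages of nonnegative functions. Finiteness is required for
  \<open>Suc l\<close> only, because the estimator does not read coordinate
  \<open>0\<close>.\<close>

lemma asymptotically_unbiased_from_start:
  fixes h :: "'a \<Rightarrow> 'b::euclidean_space"
  assumes x: "x \<in> \<Omega>" and int: "integrable (target \<Omega> p) h"
    and fin: "\<And>l. (T ^^ Suc l) (weighted (\<lambda>x. ennreal (norm (h x)))) (start x) < \<top>"
    and conv: "\<And>b. b \<in> Basis \<union> uminus ` Basis \<Longrightarrow>
      (\<lambda>n. avg n (T (weighted (\<lambda>x. ennreal (h x \<bullet> b)))) (start x))
        \<longlonglongrightarrow> (\<integral>\<^sup>+x. ennreal (h x \<bullet> b) \<partial>target \<Omega> p)"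
  shows "asymptotically_unbiased (mp_run \<Omega> N p \<kappa> x) (is_estimator N p \<kappa> h) (\<integral>x. h x \<partial>target \<Omega> p)"
proof -
  have sets_target: "sets (target \<Omega> p) = sets L" by (simp add: target_def)
  have h[measurable]: "h \<in> borel_measurable L"
    using borel_measurable_integrable[OF int] by (simp add: measurable_cong_sets[OF sets_target refl])
  interpret chain_from S K "start x" by unfold_locales (rule start_in_space[OF x])
  have coord: "\<omega> l \<in> space S" if "\<omega> \<in> space law" for \<omega> l
    using measurable_space[OF coordinate_measurable that] .
  have finite_law: "(\<integral>\<^sup>+\<omega>. weighted \<phi> (\<omega> l) \<partial>law) < \<top>"
    if "1 \<le> l" "\<phi> \<in> borel_measurable L" "\<And>x. \<phi> x \<le> ennreal (norm (h x))" for \<phi> l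
  proof -
    have "(\<integral>\<^sup>+\<omega>. weighted \<phi> (\<omega> l) \<partial>law) = (T ^^ l) (weighted \<phi>) (start x)"
      using that by (intro nn_integral_coordinate weighted_measurable)
    also have "\<dots> \<le> (T ^^ l) (weighted (\<lambda>x. ennreal (norm (h x)))) (start x)"
      using that by (intro T_pow_mono start_in_space x weighted_mono)
    also have "\<dots> < \<top>" using fin[of "l - 1"] that by simp
    finally show ?thesis .
  qed
  have integrable: "integrable law (\<lambda>\<omega>. average h (\<omega> l))" if "1 \<le> l" for l
  proof (rule integrableI_bounded)
    have "(\<integral>\<^sup>+\<omega>. ennreal (norm (average h (\<omega> l))) \<partial>law)
        \<le> (\<integral>\<^sup>+\<omega>. weighted (\<lambda>x. ennreal (norm (h x))) (\<omega> l) \<partial>law)"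
      by (intro nn_integral_mono norm_average_le coord)
    also have "\<dots> < \<top>" using that by (intro finite_law) auto
    finally show "(\<integral>\<^sup>+\<omega>. ennreal (norm (average h (\<omega> l))) \<partial>law) < \<infinity>" by simp
  qed (intro measurable_compose[OF coordinate_measurable average_measurable] h)
  have estimator_integrable: "integrable law (is_estimator N p \<kappa> h n)" for n
    unfolding is_estimator_eq[abs_def] 
    by (intro integrable_scaleR_right Bochner_Integration.integrable_sum integrable) auto
  let ?W = "\<lambda>b. weighted (\<lambda>x. ennreal (h x \<bullet> b))"
  have inner_le: "ennreal (h x \<bullet> b) \<le> ennreal (norm (h x))" if "b \<in> Basis \<union> uminus ` Basis" for x b
    using that by (intro ennreal_leI inner_signed_Basis_le_norm)
  have W_fin: "(T ^^ l) (?W b) (start x) < \<top>" if "1 \<le> l" "b \<in> Basis \<union> uminus ` Basis" for b l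
  proof -
    have "(T ^^ l) (?W b) (start x) = (\<integral>\<^sup>+\<omega>. ?W b (\<omega> l) \<partial>law)"
      by (intro nn_integral_coordinate[symmetric]) measurable
    also have "\<dots> < \<top>" using that inner_le by (intro finite_law) auto
    finally show ?thesis .
  qed
  have avg_real: "enn2real (avg n (T (?W b)) (start x))
      = (\<Sum>l = 1..n. enn2real ((T ^^ l) (?W b) (start x))) / real n"
    if "b \<in> Basis \<union> uminus ` Basis" for b n
  proof -
    \<comment> \<open>Averaging \<open>T (?W b)\<close> shifts the exponents from
      \<open>0..n-1\<close> to \<open>1..n\<close>, the range of iterations in the
      estimator.\<close>
    have "avg n (T (?W b)) (start x) = (\<Sum>l<n. (T ^^ Suc l) (?W b) (start x)) / of_nat n"
      unfolding ergodic_average_def by (simp only: funpow_Suc_right o_def)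
    also have "\<dots> = (\<Sum>l = 1..n. (T ^^ l) (?W b) (start x)) / of_nat n"
      by (simp only: One_nat_def sum.atLeast1_atMost_eq)
    finally show ?thesis
      using W_fin that by (subst enn2real_sum_finite[symmetric]) (auto simp: enn2real_divide_of_nat)
  qed
  have average_component: "(\<integral>\<omega>. average h (\<omega> l) \<partial>law) \<bullet> b
      = enn2real ((T ^^ l) (?W b) (start x)) - enn2real ((T ^^ l) (?W (- b)) (start x))"
    if b: "b \<in> Basis" and l: "1 \<le> l" for b l
  proof -
    \<comment> \<open>The real-valued counterpart of \<open>?W c\<close>, chosen so that
      \<open>P b - P (- b)\<close> is the coordinate of \<open>average h\<close> along
      \<open>b\<close>.\<close>
    define P where "P c s = average (\<lambda>x. max 0 (h x \<bullet> c)) s" for c s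
    have [measurable]: "P c \<in> borel_measurable S" for c unfolding P_def by measurable
    have P: "ennreal (P c s) = ?W c s" "0 \<le> P c s" if "s \<in> space S" for c s
    proof -
      show "ennreal (P c s) = ?W c s"
        using weighted_ennreal[OF that, of "\<lambda>x. max 0 (h x \<bullet> c)"]
        by (simp add: P_def ennreal_max_0)
      show "0 \<le> P c s" using that unfolding P_def average_def
        by (auto simp: space_S intro!: sum_nonneg mult_nonneg_nonneg weight_nonneg)
    qed
    have nn_P: "(\<integral>\<^sup>+\<omega>. ennreal (P c (\<omega> l)) \<partial>law) = (T ^^ l) (?W c) (start x)" for c
    proof -
      have "(\<integral>\<^sup>+\<omega>. ennreal (P c (\<omega> l)) \<partial>law) = (\<integral>\<^sup>+\<omega>. ?W c (\<omega> l) \<partial>law)"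
        by (intro nn_integral_cong P coord)
      also have "\<dots> = (T ^^ l) (?W c) (start x)"
        by (intro nn_integral_coordinate) measurable
      finally show ?thesis .
    qed
    have P_int: "(\<integral>\<omega>. P c (\<omega> l) \<partial>law) = enn2real ((T ^^ l) (?W c) (start x))" for c
      using P(2) coord by (subst integral_eq_nn_integral) (auto simp: nn_P)
    have P_integrable: "integrable law (\<lambda>\<omega>. P c (\<omega> l))" if "c \<in> Basis \<union> uminus ` Basis" for c
      using P(2) coord W_fin[OF l that] by (intro integrableI_nonneg) (auto simp: nn_P)
    have "(\<integral>\<omega>. average h (\<omega> l) \<partial>law) \<bullet> b = (\<integral>\<omega>. average h (\<omega> l) \<bullet> b \<partial>law)"
      using integrable[OF l] by (intro integral_inner_left[symmetric]) auto
    also have "\<dots> = (\<integral>\<omega>. P b (\<omega> l) - P (- b) (\<omega> l) \<partial>law)"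
      unfolding P_def average_def
      by (intro Bochner_Integration.integral_cong refl)
         (auto simp: inner_sum_left simp flip: sum_subtractf right_diff_distrib intro!: sum.cong)
    also have "\<dots> = (\<integral>\<omega>. P b (\<omega> l) \<partial>law) - (\<integral>\<omega>. P (- b) (\<omega> l) \<partial>law)"
      using b by (intro Bochner_Integration.integral_diff P_integrable) auto
    finally show ?thesis by (simp add: P_int)
  qed
  have "(\<lambda>n. (\<integral>\<omega>. is_estimator N p \<kappa> h n \<omega> \<partial>law) \<bullet> b) \<longlonglongrightarrow> (\<integral>x. h x \<partial>target \<Omega> p) \<bullet> b"
    if b: "b \<in> Basis" for b
  proof -
    have bs: "b \<in> Basis \<union> uminus ` Basis" "- b \<in> Basis \<union> uminus ` Basis" using b by auto
    have nn_fin: "(\<integral>\<^sup>+x. ennreal (h x \<bullet> c) \<partial>target \<Omega> p) < \<top>" if "c \<in> Basis \<union> uminus ` Basis" for c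
    proof -
      have "(\<integral>\<^sup>+x. ennreal (h x \<bullet> c) \<partial>target \<Omega> p) \<le> (\<integral>\<^sup>+x. ennreal (norm (h x)) \<partial>target \<Omega> p)"
        by (intro nn_integral_mono inner_le that)
      also have "\<dots> < \<top>" using int by (simp add: integrable_iff_bounded)
      finally show ?thesis .
    qed
    have "(\<integral>x. h x \<partial>target \<Omega> p) \<bullet> b = (\<integral>x. h x \<bullet> b \<partial>target \<Omega> p)"
      using int by (intro integral_inner_left[symmetric]) auto
    also have "\<dots> = enn2real (\<integral>\<^sup>+x. ennreal (h x \<bullet> b) \<partial>target \<Omega> p)
        - enn2real (\<integral>\<^sup>+x. ennreal (h x \<bullet> (- b)) \<partial>target \<Omega> p)"
      using int by (subst real_lebesgue_integral_def) auto
    finally have limit: "(\<integral>x. h x \<partial>target \<Omega> p) \<bullet> b = \<dots>" .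
    have "(\<integral>\<omega>. is_estimator N p \<kappa> h n \<omega> \<partial>law) \<bullet> b
        = enn2real (avg n (T (?W b)) (start x)) - enn2real (avg n (T (?W (- b))) (start x))" for n
    proof -
      have "(\<integral>\<omega>. is_estimator N p \<kappa> h n \<omega> \<partial>law)
          = (1 / real n) *\<^sub>R (\<Sum>l = 1..n. \<integral>\<omega>. average h (\<omega> l) \<partial>law)"
        unfolding is_estimator_eq
        by (subst integral_scaleR_right, subst Bochner_Integration.integral_sum) (auto intro: integrable)
      also have "\<dots> \<bullet> b = (\<Sum>l = 1..n. (\<integral>\<omega>. average h (\<omega> l) \<partial>law) \<bullet> b) / real n"
        by (simp add: inner_sum_left)
      also have "\<dots> = (\<Sum>l = 1..n. enn2real ((T ^^ l) (?W b) (start x))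
          - enn2real ((T ^^ l) (?W (- b)) (start x))) / real n"
        using b by (intro arg_cong2[where f="(/)"] sum.cong refl average_component) auto
      finally show ?thesis
        by (simp only: avg_real[OF bs(1)] avg_real[OF bs(2)] sum_subtractf diff_divide_distrib)
    qed
    then show ?thesis
      unfolding limit by (simp only:) (intro tendsto_diff tendsto_enn2real_finite conv nn_fin bs)
  qed
  then have "(\<lambda>n. \<integral>\<omega>. is_estimator N p \<kappa> h n \<omega> \<partial>law) \<longlonglongrightarrow> (\<integral>x. h x \<partial>target \<Omega> p)"
    by (subst tendsto_componentwise_iff) auto
  then show ?thesis
    unfolding asymptotically_unbiased_def mp_run_eq using estimator_integrable by simp
qed

end

section \<open>Consequences of positive Harris recurrence\<close>

locale mp_algorithm_harris = mp_algorithm +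
  assumes harris: "positive_harris S K"
begin

text \<open>A bound on \<open>h\<close> passes to the weighted sums, because the weights form a
  probability vector, and then to all powers of \<open>T\<close>; so finiteness and convergence hold
  at every starting state.\<close>

lemma asymptotically_unbiased_bounded:
  fixes h :: "'a \<Rightarrow> 'b::euclidean_space"
  assumes int: "integrable (target \<Omega> p) h" and bd: "bounded (h ` \<Omega>)" and x: "x \<in> \<Omega>"
  shows "asymptotically_unbiased (mp_run \<Omega> N p \<kappa> x) (is_estimator N p \<kappa> h) (\<integral>x. h x \<partial>target \<Omega> p)"
proof (rule asymptotically_unbiased_from_start[OF x int])
  obtain \<psi> where "harris_kernel S K stationary \<psi>"
    using positive_harris_harris_kernel[OF harris invariant_stationary] .
  then interpret harris_kernel S K stationary \<psi> .
  have sets_target: "sets (target \<Omega> p) = sets L" by (simp add: target_def)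
  have h[measurable]: "h \<in> borel_measurable L"
    using borel_measurable_integrable[OF int] by (simp add: measurable_cong_sets[OF sets_target refl])
  obtain B where B: "\<And>x. x \<in> \<Omega> \<Longrightarrow> norm (h x) \<le> B"
    using bd by (auto simp: bounded_iff)
  show "(T ^^ Suc l) (weighted (\<lambda>x. ennreal (norm (h x)))) (start x) < \<top>" for l
  proof -
    have "(T ^^ Suc l) (weighted (\<lambda>x. ennreal (norm (h x)))) (start x) \<le> ennreal B"
      using B by (intro T_pow_le weighted_le start_in_space x) (auto intro: ennreal_leI)
    then show ?thesis by (rule le_less_trans) simp
  qed
  fix b :: 'b assume b: "b \<in> Basis \<union> uminus ` Basis"
  have W_le: "weighted (\<lambda>x. ennreal (h x \<bullet> b)) s \<le> ennreal B" if "s \<in> space S" for s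
  proof (rule weighted_le[OF that], rule ennreal_leI)
    fix x assume "x \<in> \<Omega>"
    have "h x \<bullet> b \<le> norm (h x)" using b by (rule inner_signed_Basis_le_norm)
    also have "\<dots> \<le> B" using \<open>x \<in> \<Omega>\<close> by (rule B)
    finally show "h x \<bullet> b \<le> B" .
  qed
  have "(\<lambda>n. avg n (T (weighted (\<lambda>x. ennreal (h x \<bullet> b)))) (start x))
      \<longlonglongrightarrow> (\<integral>\<^sup>+s. T (weighted (\<lambda>x. ennreal (h x \<bullet> b))) s \<partial>stationary)"
  proof (rule tendsto_avg_bounded[where B="ennreal B"])
    show "T (weighted (\<lambda>x. ennreal (h x \<bullet> b))) s \<le> ennreal B" if "s \<in> space S" for s
      using T_pow_le[OF that W_le, where n=1] by simp
  qed (use start_in_space[OF x] in \<open>auto intro!: T_measurable weighted_measurable\<close>)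
  then show "(\<lambda>n. avg n (T (weighted (\<lambda>x. ennreal (h x \<bullet> b)))) (start x))
      \<longlonglongrightarrow> (\<integral>\<^sup>+x. ennreal (h x \<bullet> b) \<partial>target \<Omega> p)"
    by (simp add: nn_integral_stationary_T nn_integral_stationary_weighted weighted_measurable)
qed

lemma AE_asymptotically_unbiased:
  fixes h :: "'a \<Rightarrow> 'b::euclidean_space"
  assumes int: "integrable (target \<Omega> p) h"
  shows "AE x in target \<Omega> p.
    asymptotically_unbiased (mp_run \<Omega> N p \<kappa> x) (is_estimator N p \<kappa> h) (\<integral>x. h x \<partial>target \<Omega> p)"
proof -
  obtain \<psi> where "harris_kernel S K stationary \<psi>"
    using positive_harris_harris_kernel[OF harris invariant_stationary] .
  then interpret harris_kernel S K stationary \<psi> .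
  have sets_target: "sets (target \<Omega> p) = sets L" by (simp add: target_def)
  have h[measurable]: "h \<in> borel_measurable L"
    using borel_measurable_integrable[OF int] by (simp add: measurable_cong_sets[OF sets_target refl])
  have int_fin: "(\<integral>\<^sup>+x. ennreal (norm (h x)) \<partial>target \<Omega> p) < \<top>"
    using int by (simp add: integrable_iff_bounded)
  \<comment> \<open>The last premise says that \<open>P\<close> looks at a state only through its
    transition probabilities, which \<open>T_start\<close> shows to agree for \<open>(y, 1)\<close>
    and \<open>start (y 1)\<close>.\<close>
  have AE_start: "AE x in target \<Omega> p. P (start x)"
    if "Measurable.pred S P" "AE s in stationary. P s"
      "\<And>s s'. (\<And>g. g \<in> borel_measurable S \<Longrightarrow> T g s = T g s') \<Longrightarrow> P s = P s'" for P
    by (rule AE_target_start[OF that(1,2)], rule that(3), rule T_start)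
  let ?V = "weighted (\<lambda>x. ennreal (norm (h x)))"
  have fin: "AE x in target \<Omega> p. T ((T ^^ l) ?V) (start x) < \<top>" for l
  proof (rule AE_start)
    have "(\<integral>\<^sup>+s. T ((T ^^ l) ?V) s \<partial>stationary) = (\<integral>\<^sup>+s. ?V s \<partial>stationary)"
      using nn_integral_T_pow[of ?V "Suc l"] by (simp add: weighted_measurable)
    also have "\<dots> < \<top>" using int_fin by (simp add: nn_integral_stationary_weighted)
    finally have "AE s in stationary. T ((T ^^ l) ?V) s \<noteq> \<infinity>"
      by (intro nn_integral_PInf_AE) auto
    then show "AE s in stationary. T ((T ^^ l) ?V) s < \<top>"
      by eventually_elim (simp add: less_top)
  next
    fix s s' assume "\<And>g. g \<in> borel_measurable S \<Longrightarrow> T g s = T g s'"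
    from this[of "(T ^^ l) ?V"] show "(T ((T ^^ l) ?V) s < \<top>) = (T ((T ^^ l) ?V) s' < \<top>)"
      by simp
  qed measurable
  let ?W = "\<lambda>b. weighted (\<lambda>x. ennreal (h x \<bullet> b))"
  have conv: "AE x in target \<Omega> p. (\<lambda>n. avg n (T (?W b)) (start x))
      \<longlonglongrightarrow> (\<integral>\<^sup>+x. ennreal (h x \<bullet> b) \<partial>target \<Omega> p)"
    if b: "b \<in> Basis \<union> uminus ` Basis" for b
  proof (rule AE_start)
    let ?m = "\<integral>\<^sup>+x. ennreal (h x \<bullet> b) \<partial>target \<Omega> p"
    have m: "(\<integral>\<^sup>+s. T (?W b) s \<partial>stationary) = ?m"
      by (simp add: nn_integral_stationary_T nn_integral_stationary_weighted weighted_measurable)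
    have "?m \<le> (\<integral>\<^sup>+x. ennreal (norm (h x)) \<partial>target \<Omega> p)"
      using b by (intro nn_integral_mono ennreal_leI inner_signed_Basis_le_norm)
    then have "?m < \<top>" using int_fin by (rule le_less_trans)
    then show "AE s in stationary. (\<lambda>n. avg n (T (?W b)) s) \<longlonglongrightarrow> ?m"
      using AE_tendsto_avg[of "T (?W b)"] by (simp add: m T_measurable weighted_measurable)
    \<comment> \<open>In this form the convergence is a measurable condition, as the lower and upper
      limits are measurable functions.\<close>
    have "((\<lambda>n. avg n (T (?W b)) s) \<longlonglongrightarrow> ?m) \<longleftrightarrow>
        liminf (\<lambda>n. avg n (T (?W b)) s) = ?m \<and> limsup (\<lambda>n. avg n (T (?W b)) s) = ?m" for s
      by (simp add: tendsto_iff_Liminf_eq_Limsup)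
    then show "Measurable.pred S (\<lambda>s. (\<lambda>n. avg n (T (?W b)) s) \<longlonglongrightarrow> ?m)"
      by simp
  next
    fix s s' assume T: "\<And>g. g \<in> borel_measurable S \<Longrightarrow> T g s = T g s'"
    \<comment> \<open>Even the term \<open>l = 0\<close> contains an application of
      \<open>T\<close>, so no term looks at the tuple beyond its current point. Averages of
      \<open>?W b\<close> itself would not have this property.\<close>
    have "(T ^^ l) (T (?W b)) s = (T ^^ l) (T (?W b)) s'" for l
      by (cases l) (auto intro!: T weighted_measurable T_pow_measurable T_measurable)
    then show "((\<lambda>n. avg n (T (?W b)) s) \<longlonglongrightarrow> (\<integral>\<^sup>+x. ennreal (h x \<bullet> b) \<partial>target \<Omega> p))
        = ((\<lambda>n. avg n (T (?W b)) s') \<longlonglongrightarrow> (\<integral>\<^sup>+x. ennreal (h x \<bullet> b) \<partial>target \<Omega> p))"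
      by (simp add: ergodic_average_def)
  qed
  \<comment> \<open>There are countably many exceptional sets: one for each time \<open>l\<close>
    and one for each signed basis vector.\<close>
  have "AE x in target \<Omega> p. \<forall>l. T ((T ^^ l) ?V) (start x) < \<top>"
    using fin by (simp add: AE_all_countable)
  moreover have "AE x in target \<Omega> p. \<forall>b\<in>Basis \<union> uminus ` Basis. (\<lambda>n. avg n (T (?W b)) (start x))
      \<longlonglongrightarrow> (\<integral>\<^sup>+x. ennreal (h x \<bullet> b) \<partial>target \<Omega> p)"
    using conv by (subst AE_finite_all) auto
  ultimately show ?thesis
    using AE_space
    by eventually_elim (intro asymptotically_unbiased_from_start int, auto simp: target_def)
qed

end

theorem lemma4p1:
  fixes \<Omega> :: "(real ^ 'd) set" and N :: nat
    and \<pi> :: "real ^ 'd \<Rightarrow> real"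
    and \<kappa> :: "real ^ 'd \<Rightarrow> (nat \<Rightarrow> real ^ 'd) \<Rightarrow> real"
    and f :: "real ^ 'd \<Rightarrow> real ^ 'e"
    and \<mu> :: "real ^ 'e"
  assumes "\<Omega> \<in> sets borel"
    and "prob_density (leb_on \<Omega>) \<pi>"
    and "proposal_kernel \<Omega> N \<kappa>"
    and "integrable (target \<Omega> \<pi>) f"
    and "\<mu> = (LINT x:\<Omega>|lborel. \<pi> x *\<^sub>R f x)"
    and "positive_harris (mp_states \<Omega> N) (mp_kernel \<Omega> N \<pi> \<kappa>)"
  shows "(AE y1 in target \<Omega> \<pi>.
            asymptotically_unbiased (mp_run \<Omega> N \<pi> \<kappa> y1) (is_estimator N \<pi> \<kappa> f) \<mu>) \<and>
         (bounded (f ` \<Omega>) \<longrightarrow>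
            (\<forall>y1\<in>\<Omega>. asymptotically_unbiased (mp_run \<Omega> N \<pi> \<kappa> y1) (is_estimator N \<pi> \<kappa> f) \<mu>))"
proof -
  interpret mp_algorithm_harris \<Omega> N \<pi> \<kappa>
    using assms by unfold_locales (auto simp: positive_harris_def)
  have sets_target: "sets (target \<Omega> \<pi>) = sets (leb_on \<Omega>)" by (simp add: target_def)
  have "f \<in> borel_measurable (leb_on \<Omega>)"
    using borel_measurable_integrable[OF assms(4)]
    by (simp add: measurable_cong_sets[OF sets_target refl])
  then have "(\<integral>x. f x \<partial>target \<Omega> \<pi>) = (\<integral>x. \<pi> x *\<^sub>R f x \<partial>leb_on \<Omega>)"
    unfolding target_def by (intro integral_density p_measurable) (auto intro!: AE_I2 p_nonneg)
  also have "\<dots> = \<mu>"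
    using assms(1) by (simp add: assms(5) integral_restrict_space set_lebesgue_integral_def)
  finally have "(\<integral>x. f x \<partial>target \<Omega> \<pi>) = \<mu>" .
  then show ?thesis
    using AE_asymptotically_unbiased[OF assms(4)] asymptotically_unbiased_bounded[OF assms(4)] by auto
qed

end
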